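(* Let $(M,\xi)$ be a smooth contact 3-manifold, let $L\subset M$ be a locally Lavrentiev curve and let $\alpha$ be a contact form (a smooth 1-form with $\ker\alpha=\xi$) defined in some neighborhood of $L$. Then $L$ is Legendrian if and only if the Riemann–Stieltjes integral of $\alpha$ on any compact subarc of $L$ is zero.
   Context: An embedded curve is a subset homeomorphic to a connected subset of a circle. Its length is $\ell(L)=\sup\sum_i \mathrm{diam}(\partial\gamma_i)$ over decompositions of $L$ into compact subarcs $\gamma_i$ without common interior points, where $\mathrm{diam}(\partial\gamma_i)$ is the distance between the endpoints of $\gamma_i$; $L$ is rectifiable if every compact subarc has finite length. $L$ is $C$-Lavrentiev if it is rectifiable and $\ell(L|_P^Q)\le C\,\mathrm{dist}(P,Q)$ for all $P,Q\in L$, where $L|_P^Q$ is a shortest subarc joining $P$ and $Q$; it is Lavrentiev if this holds for some $C$; it is locally Lavrentiev if every $p\in L$ has a neighborhood $U$ such that $L\cap U$ is a Lavrentiev curve. On a smooth manifold "locally Lavrentiev" is understood with respect to some (equivalently any) smooth Riemannian metric. A contact structure $\xi$ on a smooth 3-manifold is a 2-plane distribution that is locally the kernel of a smooth 1-form $\alpha$ with $\alpha\wedge d\alpha\ne0$ everywhere; $\xi_p$ is the plane at $p$. A locally Lavrentiev curve $L$ is Legendrian if for any $p\in L$ and any (equivalently some) Euclidean coordinates of class $C^1$ in a neighborhood of $p$: for any $\varepsilon>0$ there is a smaller neighborhood $U\ni p$ such that $\angle(p''-p',\xi_p)<\varepsilon$ for any two distinct points $p',p''\in L\cap U$ (differences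 and angles are computed in the coordinates). *)

theory Defs
  imports "HOL-Analysis.Analysis"
begin

text \<open>
  The manifold \<open>M\<close> is the universe of a Hausdorff, second countable type \<open>'a\<close>; its smooth
  structure is given by an atlas, which need not be maximal.
\<close>

section \<open>Smooth 3-manifolds\<close>

text \<open>Meaningful for open \<open>S\<close> and finite-dimensional \<open>'a\<close>, the only case used below.\<close>

primrec Ck_on :: "nat \<Rightarrow> ('a::real_normed_vector \<Rightarrow> 'b::real_normed_vector) \<Rightarrow> 'a set \<Rightarrow> bool" where
  "Ck_on 0 f S \<longleftrightarrow> continuous_on S f"
| "Ck_on (Suc k) f S \<longleftrightarrow>
     (\<forall>x\<in>S. f differentiable (at x)) \<and> (\<forall>v. Ck_on k (\<lambda>x. frechet_derivative f (at x) v) S)"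

definition smooth_on :: "('a::real_normed_vector \<Rightarrow> 'b::real_normed_vector) \<Rightarrow> 'a set \<Rightarrow> bool" where
  "smooth_on f S \<longleftrightarrow> (\<forall>k. Ck_on k f S)"

type_synonym 'a chart = "'a set \<times> ('a \<Rightarrow> real^3)"

abbreviation chart_dom :: "'a chart \<Rightarrow> 'a set" where "chart_dom c \<equiv> fst c"
abbreviation crd :: "'a chart \<Rightarrow> 'a \<Rightarrow> real^3" where "crd c \<equiv> snd c"
abbreviation crd_inv :: "'a chart \<Rightarrow> real^3 \<Rightarrow> 'a" where "crd_inv c \<equiv> inv_into (chart_dom c) (crd c)"

definition is_chart :: "'a::topological_space chart \<Rightarrow> bool" where
  "is_chart c \<longleftrightarrow> open (chart_dom c) \<and> open (crd c ` chart_dom c) \<and>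
     homeomorphism (chart_dom c) (crd c ` chart_dom c) (crd c) (crd_inv c)"

definition Ck_compatible :: "nat \<Rightarrow> 'a chart \<Rightarrow> 'a chart \<Rightarrow> bool" where
  "Ck_compatible k c c' \<longleftrightarrow>
     Ck_on k (crd c' \<circ> crd_inv c) (crd c ` (chart_dom c \<inter> chart_dom c')) \<and>
     Ck_on k (crd c \<circ> crd_inv c') (crd c' ` (chart_dom c \<inter> chart_dom c'))"

definition smooth_atlas :: "'a::topological_space chart set \<Rightarrow> bool" where
  "smooth_atlas A \<longleftrightarrow> (\<forall>c\<in>A. is_chart c) \<and> (\<Union>c\<in>A. chart_dom c) = UNIV \<and>
     (\<forall>c\<in>A. \<forall>c'\<in>A. \<forall>k. Ck_compatible k c c')"

definition C1_coordinates :: "'a::topological_space chart set \<Rightarrow> 'a chart \<Rightarrow> bool" where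
  "C1_coordinates A c \<longleftrightarrow> is_chart c \<and> (\<forall>c'\<in>A. Ck_compatible 1 c c')"

section \<open>Tangent vectors, plane fields, 1-forms and metrics\<close>

text \<open>
  A tangent vector at \<open>p\<close> is a directional derivative operator. It acts on all functions that are
  differentiable at \<open>p\<close> (a notion that does not depend on the chart, even among \<open>C\<^sup>1\<close> charts) and
  is \<open>0\<close> by convention on the others, so that equality of operators is equality of vectors and a
  vector may be applied to \<open>C\<^sup>1\<close> coordinates.
\<close>

type_synonym 'a tvec = "('a \<Rightarrow> real) \<Rightarrow> real"

definition tangent_vec :: "'a chart \<Rightarrow> 'a \<Rightarrow> real^3 \<Rightarrow> 'a tvec" where
  "tangent_vec c p v = (\<lambda>f. if (f \<circ> crd_inv c) differentiable (at (crd c p))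
     then frechet_derivative (f \<circ> crd_inv c) (at (crd c p)) v else 0)"

definition tangent_space :: "'a chart set \<Rightarrow> 'a \<Rightarrow> 'a tvec set" where
  "tangent_space A p = {tangent_vec c p v |c v. c \<in> A \<and> p \<in> chart_dom c}"

text \<open>The differential of the coordinate map, i.e. the components of a tangent vector.\<close>

definition components :: "'a chart \<Rightarrow> 'a tvec \<Rightarrow> real^3" where
  "components c X = (\<chi> i. X (\<lambda>q. crd c q $ i))"

definition plane_field :: "'a chart set \<Rightarrow> ('a \<Rightarrow> 'a tvec set) \<Rightarrow> bool" where
  "plane_field A \<xi> \<longleftrightarrow> (\<forall>p. \<forall>c\<in>A. p \<in> chart_dom c \<longrightarrow>
     (\<exists>P. subspace P \<and> dim P = 2 \<and> \<xi> p = tangent_vec c p ` P))"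

text \<open>The coefficients \<open>a\<close> of \<open>\<alpha> = a\<^sub>1 dx\<^sub>1 + a\<^sub>2 dx\<^sub>2 + a\<^sub>3 dx\<^sub>3\<close>, as functions of the coordinates.\<close>

definition form_coeffs :: "('a \<Rightarrow> 'a tvec \<Rightarrow> real) \<Rightarrow> 'a chart \<Rightarrow> real^3 \<Rightarrow> real^3" where
  "form_coeffs \<alpha> c x = (\<chi> i. \<alpha> (crd_inv c x) (tangent_vec c (crd_inv c x) (axis i 1)))"

definition smooth_one_form_on :: "'a chart set \<Rightarrow> 'a set \<Rightarrow> ('a \<Rightarrow> 'a tvec \<Rightarrow> real) \<Rightarrow> bool" where
  "smooth_one_form_on A W \<alpha> \<longleftrightarrow> (\<forall>c\<in>A.
     (\<forall>p\<in>W \<inter> chart_dom c. linear (\<lambda>v. \<alpha> p (tangent_vec c p v))) \<and>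
     smooth_on (form_coeffs \<alpha> c) (crd c ` (W \<inter> chart_dom c)))"

definition form_kernel :: "'a chart set \<Rightarrow> ('a \<Rightarrow> 'a tvec \<Rightarrow> real) \<Rightarrow> 'a \<Rightarrow> 'a tvec set" where
  "form_kernel A \<alpha> p = {X \<in> tangent_space A p. \<alpha> p X = 0}"

text \<open>The exterior derivative at \<open>x\<close> of the 1-form on \<open>\<real>\<^sup>3\<close> with coefficients \<open>a\<close>.\<close>

definition ext_deriv :: "(real^3 \<Rightarrow> real^3) \<Rightarrow> real^3 \<Rightarrow> real^3 \<Rightarrow> real^3 \<Rightarrow> real" where
  "ext_deriv a x u v = frechet_derivative a (at x) u \<bullet> v - frechet_derivative a (at x) v \<bullet> u"

text \<open>The wedge product of a linear form and an alternating bilinear form.\<close>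

definition wedge12 :: "('v \<Rightarrow> real) \<Rightarrow> ('v \<Rightarrow> 'v \<Rightarrow> real) \<Rightarrow> 'v \<Rightarrow> 'v \<Rightarrow> 'v \<Rightarrow> real" where
  "wedge12 \<beta> \<omega> u v w = \<beta> u * \<omega> v w + \<beta> v * \<omega> w u + \<beta> w * \<omega> u v"

definition wedge_ext_deriv_nonzero_on ::
    "'a chart set \<Rightarrow> 'a set \<Rightarrow> ('a \<Rightarrow> 'a tvec \<Rightarrow> real) \<Rightarrow> bool" where
  "wedge_ext_deriv_nonzero_on A W \<alpha> \<longleftrightarrow> (\<forall>c\<in>A. \<forall>x\<in>crd c ` (W \<inter> chart_dom c). \<exists>u v w.
     wedge12 (\<lambda>z. form_coeffs \<alpha> c x \<bullet> z) (ext_deriv (form_coeffs \<alpha> c) x) u v w \<noteq> 0)"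

definition contact_structure ::
    "'a::topological_space chart set \<Rightarrow> ('a \<Rightarrow> 'a tvec set) \<Rightarrow> bool" where
  "contact_structure A \<xi> \<longleftrightarrow> plane_field A \<xi> \<and>
     (\<forall>p. \<exists>W \<beta>. open W \<and> p \<in> W \<and> smooth_one_form_on A W \<beta> \<and>
        wedge_ext_deriv_nonzero_on A W \<beta> \<and> (\<forall>q\<in>W. \<xi> q = form_kernel A \<beta> q))"

definition contact_form_on ::
    "'a chart set \<Rightarrow> ('a \<Rightarrow> 'a tvec set) \<Rightarrow> 'a set \<Rightarrow> ('a \<Rightarrow> 'a tvec \<Rightarrow> real) \<Rightarrow> bool" where
  "contact_form_on A \<xi> W \<alpha> \<longleftrightarrow> smooth_one_form_on A W \<alpha> \<and> (\<forall>q\<in>W. form_kernel A \<alpha> q = \<xi> q)"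

definition metric_coord ::
    "('a \<Rightarrow> 'a tvec \<Rightarrow> 'a tvec \<Rightarrow> real) \<Rightarrow> 'a chart \<Rightarrow> real^3 \<Rightarrow> real^3 \<Rightarrow> real^3 \<Rightarrow> real" where
  "metric_coord g c x u v =
     g (crd_inv c x) (tangent_vec c (crd_inv c x) u) (tangent_vec c (crd_inv c x) v)"

definition riemannian_metric :: "'a chart set \<Rightarrow> ('a \<Rightarrow> 'a tvec \<Rightarrow> 'a tvec \<Rightarrow> real) \<Rightarrow> bool" where
  "riemannian_metric A g \<longleftrightarrow> (\<forall>c\<in>A.
     (\<forall>x\<in>crd c ` chart_dom c. bilinear (metric_coord g c x) \<and>
        (\<forall>u v. metric_coord g c x u v = metric_coord g c x v u) \<and>
        (\<forall>v. v \<noteq> 0 \<longrightarrow> metric_coord g c x v v > 0)) \<and>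
     (\<forall>u v. smooth_on (\<lambda>x. metric_coord g c x u v) (crd c ` chart_dom c)))"

section \<open>Riemannian distance\<close>

definition chart_subdivision ::
    "'a chart set \<Rightarrow> (real \<Rightarrow> 'a) \<Rightarrow> nat \<Rightarrow> (nat \<Rightarrow> real) \<Rightarrow> (nat \<Rightarrow> 'a chart) \<Rightarrow> bool" where
  "chart_subdivision A \<gamma> n \<tau> c \<longleftrightarrow> \<tau> 0 = 0 \<and> \<tau> n = 1 \<and>
     (\<forall>i<n. \<tau> i < \<tau> (Suc i) \<and> c i \<in> A \<and> \<gamma> ` {\<tau> i..\<tau> (Suc i)} \<subseteq> chart_dom (c i))"

text \<open>\<open>\<gamma>\<close> is a piecewise \<open>C\<^sup>1\<close> path (one-sided derivatives at the breakpoints) of length \<open>l\<close>.\<close>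

definition has_riemannian_length :: "'a::topological_space chart set \<Rightarrow>
    ('a \<Rightarrow> 'a tvec \<Rightarrow> 'a tvec \<Rightarrow> real) \<Rightarrow> (real \<Rightarrow> 'a) \<Rightarrow> real \<Rightarrow> bool" where
  "has_riemannian_length A g \<gamma> l \<longleftrightarrow> path \<gamma> \<and> (\<exists>n \<tau> c D. chart_subdivision A \<gamma> n \<tau> c \<and>
     (\<forall>i<n. continuous_on {\<tau> i..\<tau> (Suc i)} (D i) \<and>
        (\<forall>t\<in>{\<tau> i..\<tau> (Suc i)}. ((crd (c i) \<circ> \<gamma>) has_vector_derivative D i t)
           (at t within {\<tau> i..\<tau> (Suc i)}))) \<and>
     l = (\<Sum>i<n. integral {\<tau> i..\<tau> (Suc i)}
            (\<lambda>t. sqrt (metric_coord g (c i) (crd (c i) (\<gamma> t)) (D i t) (D i t)))))"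

text \<open>The distance is infinite between different components of \<open>M\<close>.\<close>

definition riemannian_dist :: "'a::topological_space chart set \<Rightarrow>
    ('a \<Rightarrow> 'a tvec \<Rightarrow> 'a tvec \<Rightarrow> real) \<Rightarrow> 'a \<Rightarrow> 'a \<Rightarrow> ennreal" where
  "riemannian_dist A g p q = Inf {ennreal l |l. \<exists>\<gamma>. has_riemannian_length A g \<gamma> l \<and>
     pathstart \<gamma> = p \<and> pathfinish \<gamma> = q}"

section \<open>Embedded curves, length, Lavrentiev curves\<close>

definition embedded_curve :: "'a::topological_space set \<Rightarrow> bool" where
  "embedded_curve L \<longleftrightarrow> (\<exists>S. S \<subseteq> sphere (0::complex) 1 \<and> connected S \<and> L homeomorphic S)"

definition compact_subarc :: "'a::topological_space set \<Rightarrow> 'a set \<Rightarrow> bool" where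
  "compact_subarc L \<gamma> \<longleftrightarrow> \<gamma> \<subseteq> L \<and> (\<exists>h. arc h \<and> path_image h = \<gamma>)"

definition arc_boundary :: "'a::topological_space set \<Rightarrow> 'a set" where
  "arc_boundary \<gamma> = {P. \<exists>h. arc h \<and> path_image h = \<gamma> \<and> (P = pathstart h \<or> P = pathfinish h)}"

definition diam :: "('a \<Rightarrow> 'a \<Rightarrow> ennreal) \<Rightarrow> 'a set \<Rightarrow> ennreal" where
  "diam d S = (SUP x\<in>S. SUP y\<in>S. d x y)"

definition subarc_decomposition :: "'a::topological_space set \<Rightarrow> 'a set set \<Rightarrow> bool" where
  "subarc_decomposition L \<D> \<longleftrightarrow> (\<forall>\<gamma>\<in>\<D>. compact_subarc L \<gamma>) \<and> \<Union>\<D> = L \<and>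
     pairwise (\<lambda>\<gamma> \<gamma>'. (\<gamma> - arc_boundary \<gamma>) \<inter> (\<gamma>' - arc_boundary \<gamma>') = {}) \<D>"

text \<open>
  Decompositions may be infinite, as they must be for non-compact \<open>L\<close>. A single point has no
  decomposition into (nondegenerate) arcs and gets length \<open>Sup {} = 0\<close>.
\<close>

definition curve_length :: "('a::topological_space \<Rightarrow> 'a \<Rightarrow> ennreal) \<Rightarrow> 'a set \<Rightarrow> ennreal" where
  "curve_length d L = (SUP \<D>\<in>{\<D>. subarc_decomposition L \<D>}. \<Sum>\<^sub>\<infinity>\<gamma>\<in>\<D>. diam d (arc_boundary \<gamma>))"

definition rectifiable :: "('a::topological_space \<Rightarrow> 'a \<Rightarrow> ennreal) \<Rightarrow> 'a set \<Rightarrow> bool" where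
  "rectifiable d L \<longleftrightarrow> (\<forall>\<gamma>. compact_subarc L \<gamma> \<longrightarrow> curve_length d \<gamma> < \<infinity>)"

definition subarc_joining :: "'a::topological_space set \<Rightarrow> 'a \<Rightarrow> 'a \<Rightarrow> 'a set \<Rightarrow> bool" where
  "subarc_joining L P Q \<gamma> \<longleftrightarrow> \<gamma> \<subseteq> L \<and>
     (if P = Q then \<gamma> = {P}
      else \<exists>h. arc h \<and> path_image h = \<gamma> \<and> pathstart h = P \<and> pathfinish h = Q)"

text \<open>On a closed curve there are two candidates for the subarc joining two distinct points.\<close>

definition shortest_subarc ::
    "('a::topological_space \<Rightarrow> 'a \<Rightarrow> ennreal) \<Rightarrow> 'a set \<Rightarrow> 'a \<Rightarrow> 'a \<Rightarrow> 'a set \<Rightarrow> bool" where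
  "shortest_subarc d L P Q \<gamma> \<longleftrightarrow> subarc_joining L P Q \<gamma> \<and>
     (\<forall>\<gamma>'. subarc_joining L P Q \<gamma>' \<longrightarrow> curve_length d \<gamma> \<le> curve_length d \<gamma>')"

definition C_lavrentiev ::
    "real \<Rightarrow> ('a::topological_space \<Rightarrow> 'a \<Rightarrow> ennreal) \<Rightarrow> 'a set \<Rightarrow> bool" where
  "C_lavrentiev C d L \<longleftrightarrow> embedded_curve L \<and> rectifiable d L \<and>
     (\<forall>P\<in>L. \<forall>Q\<in>L. \<exists>\<gamma>. shortest_subarc d L P Q \<gamma> \<and> curve_length d \<gamma> \<le> ennreal C * d P Q)"

definition lavrentiev :: "('a::topological_space \<Rightarrow> 'a \<Rightarrow> ennreal) \<Rightarrow> 'a set \<Rightarrow> bool" where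
  "lavrentiev d L \<longleftrightarrow> (\<exists>C. C_lavrentiev C d L)"

definition locally_lavrentiev :: "('a::topological_space \<Rightarrow> 'a \<Rightarrow> ennreal) \<Rightarrow> 'a set \<Rightarrow> bool" where
  "locally_lavrentiev d L \<longleftrightarrow> embedded_curve L \<and>
     (\<forall>p\<in>L. \<exists>U. open U \<and> p \<in> U \<and> lavrentiev d (L \<inter> U))"

definition locally_lavrentiev_in :: "'a::topological_space chart set \<Rightarrow> 'a set \<Rightarrow> bool" where
  "locally_lavrentiev_in A L \<longleftrightarrow>
     (\<exists>g. riemannian_metric A g \<and> locally_lavrentiev (riemannian_dist A g) L)"

section \<open>Legendrian curves\<close>

definition vector_angle :: "real^3 \<Rightarrow> real^3 \<Rightarrow> real" where
  "vector_angle u v = arccos (u \<bullet> v / (norm u * norm v))"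

definition angle_to_plane :: "real^3 \<Rightarrow> (real^3) set \<Rightarrow> real" where
  "angle_to_plane u P = (INF v\<in>P - {0}. vector_angle u v)"

definition legendrian ::
    "'a::topological_space chart set \<Rightarrow> ('a \<Rightarrow> 'a tvec set) \<Rightarrow> 'a set \<Rightarrow> bool" where
  "legendrian A \<xi> L \<longleftrightarrow> (\<forall>p\<in>L. \<forall>c. C1_coordinates A c \<and> p \<in> chart_dom c \<longrightarrow>
     (\<forall>\<epsilon>>0. \<exists>U. open U \<and> p \<in> U \<and> U \<subseteq> chart_dom c \<and>
        (\<forall>p'\<in>L \<inter> U. \<forall>p''\<in>L \<inter> U. p' \<noteq> p'' \<longrightarrow>
           angle_to_plane (crd c p'' - crd c p') (components c ` \<xi> p) < \<epsilon>)))"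

section \<open>Riemann-Stieltjes integral of a 1-form\<close>

text \<open>
  The integral of \<open>f\<^sub>1 dh\<^sub>1 + f\<^sub>2 dh\<^sub>2 + f\<^sub>3 dh\<^sub>3\<close> over \<open>[a,b]\<close>. The constant gauge makes this the limit of
  Riemann-Stieltjes sums as the mesh tends to \<open>0\<close>.
\<close>

definition has_RS_integral ::
    "(real \<Rightarrow> real^3) \<Rightarrow> (real \<Rightarrow> real^3) \<Rightarrow> real \<Rightarrow> real \<Rightarrow> real \<Rightarrow> bool" where
  "has_RS_integral f h a b I \<longleftrightarrow> (\<forall>\<epsilon>>0. \<exists>\<delta>>0. \<forall>\<D>.
     \<D> tagged_division_of {a..b} \<and> (\<lambda>t. ball t \<delta>) fine \<D> \<longrightarrow>
     \<bar>(\<Sum>(t,K)\<in>\<D>. f t \<bullet> (h (Sup K) - h (Inf K))) - I\<bar> < \<epsilon>)"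

definition has_form_integral :: "'a::topological_space chart set \<Rightarrow>
    ('a \<Rightarrow> 'a tvec \<Rightarrow> real) \<Rightarrow> (real \<Rightarrow> 'a) \<Rightarrow> real \<Rightarrow> bool" where
  "has_form_integral A \<alpha> \<gamma> I \<longleftrightarrow> (\<exists>n \<tau> c J. chart_subdivision A \<gamma> n \<tau> c \<and>
     (\<forall>i<n. has_RS_integral (\<lambda>t. form_coeffs \<alpha> (c i) (crd (c i) (\<gamma> t))) (\<lambda>t. crd (c i) (\<gamma> t))
        (\<tau> i) (\<tau> (Suc i)) (J i)) \<and>
     I = (\<Sum>i<n. J i))"

end

theory Submission
  imports Defs
begin

text \<open>
  The Riemannian distance is locally comparable with the Euclidean distance in a chart, so the
  coordinates of a subarc have variation at most a constant times its Riemannian length.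

  If \<open>L\<close> is Legendrian, then near any of its points \<open>\<bar>\<alpha>(p'' - p')\<bar> \<le> \<eta> \<bar>p'' - p'\<bar>\<close> on \<open>L\<close> with \<open>\<eta>\<close>
  arbitrarily small. Fine Riemann-Stieltjes sums are thus at most \<open>\<eta>\<close> times the variation, which is
  finite by rectifiability, and the integral vanishes.

  Conversely, let \<open>p', p''\<close> be points of \<open>L\<close> close to \<open>p\<close>. The shortest subarc between them has length
  \<open>O(\<bar>p'' - p'\<bar>)\<close> by the Lavrentiev condition, so it stays near \<open>p\<close>, where \<open>\<alpha>\<close> differs little from
  its value \<open>\<alpha>\<^sub>p\<close> with frozen coefficients. Since \<open>\<alpha>\<close> integrates to \<open>0\<close> along it, \<open>\<alpha>\<^sub>p(p'' - p')\<close> is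
  \<open>o(\<bar>p'' - p'\<bar>)\<close>. Strict differentiability of the transition maps carries this over to all \<open>C\<^sup>1\<close>
  coordinates.
\<close>

section \<open>Charts and transition maps\<close>

text \<open>Two features of the definitions shape the argument. The coordinates in the Legendrian
  condition, and the charts and the subdivision that witness \<open>has_form_integral\<close>, are
  arbitrary, so every estimate has to survive a change of chart. Strict differentiability achieves
  this: the error is relative to the chord between two moving points, not to their distance from a
  base point. Moreover, the Riemannian distance is an infimum over all paths in M, including those
  that leave the chart. It bounds coordinate increments only because a path that starts well inside
  a coordinate ball and leaves it has a length bounded below. All constants in the converse are
  linear in the chord: if K compares distance and coordinates and C is a Lavrentiev constant, the
  subarc over a chord of coordinate length n has variation at most K * C * K * n. Freezing the
  coefficients with a small relative error therefore costs a small multiple of n.\<close>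

lemma C1_strict_derivative:
  fixes f :: "'a::euclidean_space \<Rightarrow> 'b::real_normed_vector"
  assumes "Ck_on 1 f S" "open S" "x0 \<in> S" "\<eta> > 0"
  obtains \<delta> where "\<delta> > 0" "ball x0 \<delta> \<subseteq> S"
    "\<And>x y. x \<in> ball x0 \<delta> \<Longrightarrow> y \<in> ball x0 \<delta> \<Longrightarrow>
       norm (f y - f x - frechet_derivative f (at x0) (y - x)) \<le> \<eta> * norm (y - x)"
proof -
  let ?F = "\<lambda>x. frechet_derivative f (at x)"
  have diff: "\<And>x. x \<in> S \<Longrightarrow> f differentiable (at x)" and
    cont: "\<And>v. continuous_on S (\<lambda>x. ?F x v)"
    using assms(1) by simp_all
  \<comment> \<open>\<open>Ck_on\<close> gives continuity of the derivative only for each fixed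
    direction; the sum over a basis dominates the operator norm, so the derivative is continuous in
    that norm as well.\<close>
  have "((\<lambda>x. \<Sum>i\<in>Basis. norm (?F x i - ?F x0 i)) \<longlongrightarrow> (\<Sum>i\<in>Basis. norm (?F x0 i - ?F x0 i))) (at x0)"
    using cont assms(2,3) by (intro tendsto_intros) (simp add: continuous_on_eq_continuous_at isCont_def)
  hence "\<forall>\<^sub>F x in at x0. (\<Sum>i\<in>Basis. norm (?F x i - ?F x0 i)) < \<eta>"
    using assms(4) by (intro order_tendstoD(2)) auto
  then obtain d where d: "d > 0" "\<And>x. x \<noteq> x0 \<Longrightarrow> dist x x0 < d \<Longrightarrow> (\<Sum>i\<in>Basis. norm (?F x i - ?F x0 i)) < \<eta>"
    unfolding eventually_at by auto
  obtain e where e: "e > 0" "ball x0 e \<subseteq> S" using assms(2,3) openE by blast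
  define \<delta> where "\<delta> = min d e"
  have sub: "ball x0 \<delta> \<subseteq> S" using e unfolding \<delta>_def by auto
  have on: "onorm (\<lambda>i. ?F x i - ?F x0 i) \<le> \<eta>" if "x \<in> ball x0 \<delta>" for x
  proof -
    have "bounded_linear (\<lambda>i. ?F x i - ?F x0 i)"
      using that sub assms(3) diff
      by (intro bounded_linear_sub has_derivative_bounded_linear[OF frechet_derivative_works[THEN iffD1]]) auto
    hence "onorm (\<lambda>i. ?F x i - ?F x0 i) \<le> (\<Sum>i\<in>Basis. norm (?F x i - ?F x0 i))"
      by (rule onorm_componentwise)
    also have "\<dots> \<le> \<eta>"
    proof (cases "x = x0")
      case True then show ?thesis using assms(4) by simp
    next
      case False then show ?thesis using d(2)[of x] that unfolding \<delta>_def by (simp add: dist_commute)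
    qed
    finally show ?thesis .
  qed
  \<comment> \<open>Mean value inequality for \<open>f\<close> minus its linearization at
    \<open>x0\<close>: on the convex ball the derivative of the difference has norm at most \<eta>,
    so both points may vary.\<close>
  have "norm (f y - f x - ?F x0 (y - x)) \<le> norm (y - x) * \<eta>" if "x \<in> ball x0 \<delta>" "y \<in> ball x0 \<delta>" for x y
  proof (rule differentiable_bound_linearization[where S = "ball x0 \<delta>"])
    show "x + t *\<^sub>R (y - x) \<in> ball x0 \<delta>" if "t \<in> {0..1}" for t
    proof -
      have "x + t *\<^sub>R (y - x) = (1 - t) *\<^sub>R x + t *\<^sub>R y" by (simp add: algebra_simps)
      thus ?thesis using convexD_alt[OF convex_ball \<open>x \<in> _\<close> \<open>y \<in> _\<close>, of t] that by auto
    qed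
    show "(f has_derivative ?F z) (at z within ball x0 \<delta>)" if "z \<in> ball x0 \<delta>" for z
      using frechet_derivative_works[THEN iffD1, OF diff] sub that has_derivative_at_withinI by blast
    show "onorm (?F z - ?F x0) \<le> \<eta>" if "z \<in> ball x0 \<delta>" for z
      using on[OF that] by (simp add: fun_diff_def)
    show "x0 \<in> ball x0 \<delta>" using d e \<delta>_def by simp
  qed
  thus thesis using that[of \<delta>] sub d(1) e(1) unfolding \<delta>_def by (simp add: mult.commute)
qed

lemma chartD:
  assumes "is_chart c"
  shows "open (chart_dom c)" "open (crd c ` chart_dom c)" "continuous_on (chart_dom c) (crd c)"
    "continuous_on (crd c ` chart_dom c) (crd_inv c)" "inj_on (crd c) (chart_dom c)"
    "\<And>p. p \<in> chart_dom c \<Longrightarrow> crd_inv c (crd c p) = p"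
    "\<And>x. x \<in> crd c ` chart_dom c \<Longrightarrow> crd c (crd_inv c x) = x"
    "\<And>x. x \<in> crd c ` chart_dom c \<Longrightarrow> crd_inv c x \<in> chart_dom c"
proof -
  have h: "homeomorphism (chart_dom c) (crd c ` chart_dom c) (crd c) (crd_inv c)"
    using assms unfolding is_chart_def by blast
  show "open (chart_dom c)" "open (crd c ` chart_dom c)"
    using assms unfolding is_chart_def by auto
  show "continuous_on (chart_dom c) (crd c)" "continuous_on (crd c ` chart_dom c) (crd_inv c)"
    using h unfolding homeomorphism_def by auto
  show inv: "\<And>p. p \<in> chart_dom c \<Longrightarrow> crd_inv c (crd c p) = p"
    using h unfolding homeomorphism_def by auto
  show "inj_on (crd c) (chart_dom c)"
    by (metis inj_onI inv)
  show "\<And>x. x \<in> crd c ` chart_dom c \<Longrightarrow> crd c (crd_inv c x) = x"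
    "\<And>x. x \<in> crd c ` chart_dom c \<Longrightarrow> crd_inv c x \<in> chart_dom c"
    by (auto simp: f_inv_into_f inv_into_into)
qed

lemma open_chart_image:
  assumes "is_chart c" "open W"
  shows "open (crd c ` (W \<inter> chart_dom c))"
proof -
  have "open (crd c ` chart_dom c \<inter> crd_inv c -` W)"
    using chartD[OF assms(1)] assms(2) continuous_open_preimage by blast
  moreover have "crd c ` chart_dom c \<inter> crd_inv c -` W = crd c ` (W \<inter> chart_dom c)"
    using chartD(6)[OF assms(1)] by force
  ultimately show ?thesis by simp
qed

lemma open_chart_preimage:
  assumes "is_chart c" "open B"
  shows "open (chart_dom c \<inter> crd c -` B)"
  using chartD[OF assms(1)] assms(2) continuous_open_preimage by blast

lemma Ck_compatible_sym: "Ck_compatible k c c' \<Longrightarrow> Ck_compatible k c' c"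
  unfolding Ck_compatible_def by (simp add: Int_commute)

lemma smooth_atlas_C1_coordinates:
  assumes "smooth_atlas A" "c \<in> A"
  shows "C1_coordinates A c"
  using assms unfolding smooth_atlas_def C1_coordinates_def by auto

abbreviation transition :: "'a chart \<Rightarrow> 'a chart \<Rightarrow> real^3 \<Rightarrow> real^3" where
  "transition c c' \<equiv> crd c' \<circ> crd_inv c"

abbreviation dtrans :: "'a chart \<Rightarrow> 'a chart \<Rightarrow> 'a \<Rightarrow> real^3 \<Rightarrow> real^3" where
  "dtrans c c' p \<equiv> frechet_derivative (transition c c') (at (crd c p))"

text \<open>Only C1 compatibility is required, so that atlas charts and arbitrary C1 coordinates are
  treated alike; \<open>swap\<close> exchanges the two charts.\<close>

locale chart_pair =
  fixes c c' :: "'a::topological_space chart"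
  assumes chart: "is_chart c" and chart': "is_chart c'" and compat: "Ck_compatible 1 c c'"
begin

lemma swap: "chart_pair c' c"
  by (rule chart_pair.intro[OF chart' chart Ck_compatible_sym[OF compat]])

lemma open_overlap: "open (crd c ` (chart_dom c \<inter> chart_dom c'))"
  using open_chart_image[OF chart chartD(1)[OF chart']] by (simp add: Int_commute)

lemma C1_trans: "Ck_on 1 (transition c c') (crd c ` (chart_dom c \<inter> chart_dom c'))"
  using compat unfolding Ck_compatible_def by blast

lemma trans_crd: "p \<in> chart_dom c \<Longrightarrow> transition c c' (crd c p) = crd c' p"
  using chartD(6)[OF chart] by simp

lemma has_derivative_trans:
  assumes "p \<in> chart_dom c" "p \<in> chart_dom c'"
  shows "(transition c c' has_derivative dtrans c c' p) (at (crd c p))"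
proof -
  have "\<forall>x\<in>crd c ` (chart_dom c \<inter> chart_dom c'). transition c c' differentiable (at x)"
    using C1_trans by simp
  thus ?thesis using assms by (blast intro: frechet_derivative_works[THEN iffD1])
qed

lemma linear_dtrans:
  assumes "p \<in> chart_dom c" "p \<in> chart_dom c'"
  shows "linear (dtrans c c' p)"
  using has_derivative_trans[OF assms] has_derivative_bounded_linear bounded_linear.linear by blast

text \<open>Chain rule, as \<open>f \<circ> crd_inv c\<close> factors through the transition map
  near \<open>crd c p\<close>. The codomain of \<open>f\<close> is general: real functions give the
  action of tangent vectors, \<open>f = crd c\<close> the inverse of \<open>dtrans\<close>.\<close>

lemma has_derivative_change:
  assumes "p \<in> chart_dom c" "p \<in> chart_dom c'"
    and "(f \<circ> crd_inv c' has_derivative F) (at (crd c' p))"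
  shows "(f \<circ> crd_inv c has_derivative F \<circ> dtrans c c' p) (at (crd c p))"
proof -
  have "((f \<circ> crd_inv c') \<circ> transition c c' has_derivative F \<circ> dtrans c c' p) (at (crd c p))"
    using assms(3) trans_crd[OF assms(1)]
    by (intro diff_chain_at has_derivative_trans[OF assms(1,2)]) simp
  moreover have "((f \<circ> crd_inv c') \<circ> transition c c') x = (f \<circ> crd_inv c) x"
    if "x \<in> crd c ` (chart_dom c \<inter> chart_dom c')" for x
    using that chartD(6)[OF chart'] chartD(6)[OF chart] by auto
  ultimately show ?thesis
    using assms(1,2) by (elim has_derivative_transform_within_open[OF _ open_overlap]) auto
qed

lemma tangent_vec_change:
  assumes "p \<in> chart_dom c" "p \<in> chart_dom c'"
  shows "tangent_vec c p v = tangent_vec c' p (dtrans c c' p v)"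
proof
  fix f :: "'a \<Rightarrow> real"
  show "tangent_vec c p v f = tangent_vec c' p (dtrans c c' p v) f"
  proof (cases "(f \<circ> crd_inv c') differentiable (at (crd c' p))")
    case True
    note h = has_derivative_change[OF assms frechet_derivative_works[THEN iffD1, OF True]]
    have "(f \<circ> crd_inv c) differentiable (at (crd c p))" using h unfolding differentiable_def by blast
    with True show ?thesis unfolding tangent_vec_def
      using frechet_derivative_at[OF h] by (metis comp_apply)
  next
    case False
    \<comment> \<open>Equality of operators includes the functions sent to 0 by convention;
      exchanging the charts shows that non-differentiability at \<open>p\<close> does not depend on
      the chart.\<close>
    have "\<not> (f \<circ> crd_inv c) differentiable (at (crd c p))"
      using False chart_pair.has_derivative_change[OF swap assms(2,1)]
        frechet_derivative_works[THEN iffD1] unfolding differentiable_def by blast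
    with False show ?thesis unfolding tangent_vec_def by simp
  qed
qed

lemma components_tangent_vec:
  assumes "p \<in> chart_dom c" "p \<in> chart_dom c'"
  shows "components c' (tangent_vec c p v) = dtrans c c' p v"
proof -
  have "tangent_vec c p v (\<lambda>q. crd c' q $ i) = dtrans c c' p v $ i" for i
  proof -
    have h: "((\<lambda>q. crd c' q $ i) \<circ> crd_inv c has_derivative (\<lambda>v. dtrans c c' p v $ i)) (at (crd c p))"
      using bounded_linear.has_derivative[OF bounded_linear_vec_nth has_derivative_trans[OF assms]]
      by (simp add: o_def)
    hence "((\<lambda>q. crd c' q $ i) \<circ> crd_inv c) differentiable (at (crd c p))"
      unfolding differentiable_def by blast
    thus ?thesis unfolding tangent_vec_def using frechet_derivative_at[OF h] by metis
  qed
  thus ?thesis unfolding components_def by (simp add: vec_eq_iff)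
qed

lemma dtrans_inverse:
  assumes "p \<in> chart_dom c" "p \<in> chart_dom c'"
  shows "dtrans c' c p (dtrans c c' p v) = v"
proof -
  have "(crd c \<circ> crd_inv c has_derivative dtrans c' c p \<circ> dtrans c c' p) (at (crd c p))"
    by (intro has_derivative_change assms chart_pair.has_derivative_trans[OF swap])
  moreover have "(crd c \<circ> crd_inv c has_derivative id) (at (crd c p))"
    by (rule has_derivative_transform_within_open[OF has_derivative_id chartD(2)[OF chart]])
      (use assms chartD(7)[OF chart] in auto)
  ultimately have "dtrans c' c p \<circ> dtrans c c' p = id" by (rule has_derivative_unique)
  thus ?thesis by (metis comp_apply id_apply)
qed

end

text \<open>Reflexivity turns the lemmas on two charts into statements about one chart, where
  \<open>dtrans c c p\<close> is the identity.\<close>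

lemma Ck_compatible_refl_1:
  assumes "is_chart c"
  shows "Ck_compatible 1 c c"
proof -
  have h: "(crd c \<circ> crd_inv c has_derivative id) (at x)" if "x \<in> crd c ` chart_dom c" for x
    by (rule has_derivative_transform_within_open[OF has_derivative_id chartD(2)[OF assms] that])
      (use chartD(7)[OF assms] in auto)
  have "frechet_derivative (crd c \<circ> crd_inv c) (at x) v = v" if "x \<in> crd c ` chart_dom c" for x v
    using frechet_derivative_at[OF h[OF that]] by (metis id_apply)
  hence "continuous_on (crd c ` chart_dom c) (\<lambda>x. frechet_derivative (crd c \<circ> crd_inv c) (at x) v)" for v
    by (subst continuous_on_cong[OF refl, where g = "\<lambda>_. v"]) auto
  moreover have "\<forall>x\<in>crd c ` chart_dom c. (crd c \<circ> crd_inv c) differentiable (at x)"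
    using h unfolding differentiable_def by blast
  ultimately show ?thesis unfolding Ck_compatible_def by simp
qed

lemma components_tangent_vec_same:
  assumes "is_chart c" "p \<in> chart_dom c"
  shows "components c (tangent_vec c p v) = v"
proof -
  interpret chart_pair c c
    by (rule chart_pair.intro[OF assms(1) assms(1) Ck_compatible_refl_1[OF assms(1)]])
  have "(crd c \<circ> crd_inv c has_derivative id) (at (crd c p))"
    by (rule has_derivative_transform_within_open[OF has_derivative_id chartD(2)[OF chart]])
      (use assms chartD(7)[OF chart] in auto)
  from frechet_derivative_at[OF this] show ?thesis
    using components_tangent_vec[OF assms(2,2)] by (metis id_apply)
qed

section \<open>Riemannian distance in a chart\<close>

text \<open>Smoothness of the metric is given only for each fixed pair of vectors; expanding the
  quadratic form in a basis yields the joint continuity that the compactness argument below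
  requires.\<close>

lemma continuous_on_metric_coord:
  assumes "riemannian_metric A g" "c \<in> A"
  shows "continuous_on (crd c ` chart_dom c \<times> UNIV) (\<lambda>(x, v). metric_coord g c x v v)"
proof -
  let ?S = "crd c ` chart_dom c"
  have bil: "bilinear (metric_coord g c x)" if "x \<in> ?S" for x
    using assms that unfolding riemannian_metric_def by blast
  have cont: "continuous_on ?S (\<lambda>x. metric_coord g c x u v)" for u v
  proof -
    have "smooth_on (\<lambda>x. metric_coord g c x u v) ?S"
      using assms unfolding riemannian_metric_def by blast
    hence "Ck_on 0 (\<lambda>x. metric_coord g c x u v) ?S" unfolding smooth_on_def by blast
    thus ?thesis by simp
  qed
  have "continuous_on (?S \<times> UNIV)
    (\<lambda>z. \<Sum>(i,j)\<in>Basis \<times> Basis. (snd z \<bullet> i) * ((snd z \<bullet> j) * metric_coord g c (fst z) i j))"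
    unfolding split_def
    by (intro continuous_intros continuous_on_compose2[OF cont, of _ fst]) auto
  moreover have "(\<Sum>(i,j)\<in>Basis \<times> Basis. (snd z \<bullet> i) * ((snd z \<bullet> j) * metric_coord g c (fst z) i j)) =
      (case z of (x, v) \<Rightarrow> metric_coord g c x v v)" if "z \<in> ?S \<times> UNIV" for z
  proof -
    obtain x v where z: "z = (x, v)" "x \<in> ?S" using \<open>z \<in> _\<close> by auto
    have "metric_coord g c x v v =
      metric_coord g c x (\<Sum>i\<in>Basis. (v \<bullet> i) *\<^sub>R i) (\<Sum>j\<in>Basis. (v \<bullet> j) *\<^sub>R j)"
      by (simp add: euclidean_representation)
    also have "\<dots> = (\<Sum>(i,j)\<in>Basis \<times> Basis. metric_coord g c x ((v \<bullet> i) *\<^sub>R i) ((v \<bullet> j) *\<^sub>R j))"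
      by (rule bilinear_sum[OF bil[OF z(2)]])
    finally show ?thesis
      using bil[OF z(2)] unfolding z(1) by (simp add: bilinear_lmul bilinear_rmul)
  qed
  ultimately show ?thesis by (simp cong: continuous_on_cong)
qed

text \<open>The metric norm attains a positive minimum and a maximum on the compact product of
  \<open>B\<close> and the unit sphere; homogeneity extends both bounds to all vectors.\<close>

lemma metric_coord_bounds:
  assumes "riemannian_metric A g" "c \<in> A" "compact B" "B \<subseteq> crd c ` chart_dom c"
  obtains K where "K > 0"
    "\<And>x (v::real^3). x \<in> B \<Longrightarrow> norm v \<le> K * sqrt (metric_coord g c x v v)"
    "\<And>x v. x \<in> B \<Longrightarrow> sqrt (metric_coord g c x v v) \<le> K * norm v"
proof (cases "B = {}")
  case True
  then show ?thesis using that[of 1] by simp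
next
  case False
  let ?F = "\<lambda>z. case z of (x, v) \<Rightarrow> sqrt (metric_coord g c x v v)"
  let ?T = "B \<times> sphere (0::real^3) 1"
  have "continuous_on ?T (\<lambda>z. sqrt ((\<lambda>(x, v). metric_coord g c x v v) z))"
    using assms(4)
    by (intro continuous_on_real_sqrt continuous_on_subset[OF continuous_on_metric_coord[OF assms(1,2)]]) auto
  hence cont: "continuous_on ?T ?F" by (simp add: split_def)
  have cT: "compact ?T" using assms(3) by (intro compact_Times) auto
  have nT: "?T \<noteq> {}" using False by (auto intro: exI[of _ "axis 1 1"] simp: norm_axis_1)
  obtain z1 where z1: "z1 \<in> ?T" "\<And>z. z \<in> ?T \<Longrightarrow> ?F z1 \<le> ?F z"
    using continuous_attains_inf[OF cT nT cont] by blast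
  obtain z2 where z2: "z2 \<in> ?T" "\<And>z. z \<in> ?T \<Longrightarrow> ?F z \<le> ?F z2"
    using continuous_attains_sup[OF cT nT cont] by blast
  define m M where "m = ?F z1" and "M = ?F z2"
  have "m > 0"
  proof -
    obtain x v where "z1 = (x, v)" "x \<in> crd c ` chart_dom c" "v \<noteq> 0"
      using z1(1) assms(4) by (metis (no_types, lifting) SigmaE dist_0_norm norm_zero subsetD mem_sphere zero_neq_one)
    thus ?thesis using assms(1,2) unfolding m_def riemannian_metric_def by auto
  qed
  moreover have "m \<le> M" using z1 z2(1) unfolding m_def M_def by blast
  ultimately have M: "M > 0" by simp
  have scale: "m * norm v \<le> sqrt (metric_coord g c x v v) \<and> sqrt (metric_coord g c x v v) \<le> M * norm v"
    if x: "x \<in> B" for x v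
  proof -
    have bil: "bilinear (metric_coord g c x)"
      using assms(1,2,4) x unfolding riemannian_metric_def by blast
    show ?thesis
    proof (cases "v = 0")
      case True
      then show ?thesis using bilinear_lzero[OF bil] by simp
    next
      case False
      let ?u = "v /\<^sub>R norm v"
      have u: "(x, ?u) \<in> ?T" using False x by simp
      have "metric_coord g c x v v = metric_coord g c x (norm v *\<^sub>R ?u) (norm v *\<^sub>R ?u)" using False by simp
      also have "\<dots> = (norm v)\<^sup>2 * metric_coord g c x ?u ?u"
        unfolding bilinear_lmul[OF bil] bilinear_rmul[OF bil] by (simp add: power2_eq_square)
      finally have "sqrt (metric_coord g c x v v) = norm v * ?F (x, ?u)"
        by (simp add: real_sqrt_mult)
      moreover have "m \<le> ?F (x, ?u)" "?F (x, ?u) \<le> M"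
        using z1(2)[OF u] z2(2)[OF u] unfolding m_def M_def by auto
      ultimately show ?thesis
        using mult_right_mono[of m "?F (x, ?u)" "norm v"] mult_right_mono[of "?F (x, ?u)" M "norm v"]
        by (simp add: mult.commute)
    qed
  qed
  \<comment> \<open>One constant for both directions: \<open>1 / m\<close> bounds the Euclidean norm
    by the metric norm, \<open>M\<close> the metric norm by the Euclidean one.\<close>
  define K where "K = max (1 / m) M"
  have K: "K > 0" "1 \<le> K * m" "M \<le> K" using M \<open>m > 0\<close> unfolding K_def
    by (auto simp: less_max_iff_disj max_def divide_simps split: if_splits)
  show ?thesis
  proof (rule that[OF K(1)])
    fix x and v :: "real^3" assume x: "x \<in> B"
    have "norm v \<le> K * m * norm v" using K(2) mult_right_mono[of 1 "K * m" "norm v"] by simp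
    also have "\<dots> \<le> K * sqrt (metric_coord g c x v v)"
      using scale[OF x, of v] K(1) by (simp add: mult.assoc)
    finally show "norm v \<le> K * sqrt (metric_coord g c x v v)" .
    show "sqrt (metric_coord g c x v v) \<le> K * norm v"
      using scale[OF x, of v] K(3) mult_right_mono[of M K "norm v"] by simp
  qed
qed

section \<open>Path length against coordinate increments\<close>

lemma (in chart_pair) metric_coord_change:
  assumes "p \<in> chart_dom c" "p \<in> chart_dom c'"
  shows "metric_coord g c (crd c p) u v = metric_coord g c' (crd c' p) (dtrans c c' p u) (dtrans c c' p v)"
  unfolding metric_coord_def
  using assms chartD(6)[OF chart] chartD(6)[OF chart'] tangent_vec_change[OF assms] by simp

lemma smooth_atlas_chart_pair:
  assumes "smooth_atlas A" "c \<in> A" "c' \<in> A"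
  shows "chart_pair c c'"
  using assms unfolding smooth_atlas_def by (intro chart_pair.intro) blast+

lemma metric_coord_nonneg:
  assumes "riemannian_metric A g" "c \<in> A" "p \<in> chart_dom c"
  shows "metric_coord g c (crd c p) v v \<ge> 0"
proof -
  have "bilinear (metric_coord g c (crd c p))" "v \<noteq> 0 \<Longrightarrow> metric_coord g c (crd c p) v v > 0"
    using assms unfolding riemannian_metric_def by blast+
  thus ?thesis using bilinear_lzero by (cases "v = 0") force+
qed

lemma continuous_on_chart_comp:
  assumes "is_chart c" "continuous_on T \<gamma>" "\<gamma> ` T \<subseteq> chart_dom c"
  shows "continuous_on T (crd c \<circ> \<gamma>)"
  using assms chartD(3) by (meson continuous_on_compose continuous_on_subset)

lemma continuous_on_speed:
  assumes "riemannian_metric A g" "c \<in> A" "is_chart c" "continuous_on T \<gamma>" "\<gamma> ` T \<subseteq> chart_dom c"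
    and "continuous_on T D"
  shows "continuous_on T (\<lambda>t. sqrt (metric_coord g c (crd c (\<gamma> t)) (D t) (D t)))"
proof -
  have "continuous_on T (\<lambda>t. (\<lambda>(x, v). metric_coord g c x v v) ((crd c \<circ> \<gamma>) t, D t))"
    using assms by (intro continuous_on_compose2[OF continuous_on_metric_coord[OF assms(1,2)]]
      continuous_on_Pair continuous_on_chart_comp) auto
  thus ?thesis by (auto intro!: continuous_on_real_sqrt)
qed

text \<open>The velocity is known in the chart \<open>c'\<close> of the subdivision, whereas the
  increment is measured in \<open>c\<close>. As the speed does not depend on the chart, the mean
  value inequality applies with \<open>K\<close> times the length run so far as majorant.\<close>

lemma increment_le_length_piece:
  assumes A: "smooth_atlas A" and g: "riemannian_metric A g" and c: "c \<in> A" and c': "c' \<in> A"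
    and ab: "a \<le> b" and c'ab: "\<gamma> ` {a..b} \<subseteq> chart_dom c'" and cab: "\<gamma> ` {a..b} \<subseteq> chart_dom c"
    and \<gamma>: "continuous_on {a..b} \<gamma>"
    and D: "continuous_on {a..b} D"
      "\<And>t. t \<in> {a..b} \<Longrightarrow> ((crd c' \<circ> \<gamma>) has_vector_derivative D t) (at t within {a..b})"
    and K: "K \<ge> 0" "\<And>q v. q \<in> \<gamma> ` {a..b} \<Longrightarrow> norm v \<le> K * sqrt (metric_coord g c (crd c q) v v)"
  shows "norm (crd c (\<gamma> b) - crd c (\<gamma> a)) \<le>
      K * integral {a..b} (\<lambda>t. sqrt (metric_coord g c' (crd c' (\<gamma> t)) (D t) (D t)))"
proof -
  interpret cc: chart_pair c' c by (rule smooth_atlas_chart_pair[OF A c' c])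
  let ?s = "\<lambda>t. sqrt (metric_coord g c' (crd c' (\<gamma> t)) (D t) (D t))"
  have cont': "continuous_on {a..b} (crd c' \<circ> \<gamma>)" "continuous_on {a..b} (crd c \<circ> \<gamma>)"
    by (rule continuous_on_chart_comp[OF cc.chart \<gamma> c'ab] continuous_on_chart_comp[OF cc.chart' \<gamma> cab])+
  have s: "continuous_on {a..b} ?s"
    by (rule continuous_on_speed[OF g c' cc.chart \<gamma> c'ab D(1)])
  show "norm (crd c (\<gamma> b) - crd c (\<gamma> a)) \<le> K * integral {a..b} ?s"
  proof (cases "a < b")
    case False
    then show ?thesis using ab by simp
  next
    case True
    have "norm ((crd c \<circ> \<gamma>) b - (crd c \<circ> \<gamma>) a) \<le> K * integral {a..b} ?s - K * integral {a..a} ?s"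
    proof (rule differentiable_bound_general[where f = "crd c \<circ> \<gamma>" and \<phi> = "\<lambda>t. K * integral {a..t} ?s",
        OF True cont'(2)])
      show "continuous_on {a..b} (\<lambda>t. K * integral {a..t} ?s)"
        using indefinite_integral_continuous_1[OF integrable_continuous_real[OF s]] by (intro continuous_intros)
      fix t assume t: "a < t" "t < b"
      have dom: "\<gamma> t \<in> chart_dom c'" "\<gamma> t \<in> chart_dom c" using t c'ab cab by auto
      have at: "at t within {a..b} = at t" using t by (simp add: at_within_Icc_at)
      have "((\<lambda>u. integral {a..u} ?s) has_vector_derivative ?s t) (at t)"
        using integral_has_vector_derivative[OF s, of t] t at by simp
      thus "((\<lambda>t. K * integral {a..t} ?s) has_vector_derivative K * ?s t) (at t)"
        by (rule has_vector_derivative_mult_right)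
      have D': "((crd c' \<circ> \<gamma>) has_derivative (\<lambda>h. h *\<^sub>R D t)) (at t)"
        using D(2)[of t] t at unfolding has_vector_derivative_def by simp
      have "(transition c' c \<circ> (crd c' \<circ> \<gamma>) has_derivative dtrans c' c (\<gamma> t) \<circ> (\<lambda>h. h *\<^sub>R D t)) (at t)"
        using cc.has_derivative_trans[OF dom] by (intro diff_chain_at D') simp
      moreover have "(transition c' c \<circ> (crd c' \<circ> \<gamma>)) u = (crd c \<circ> \<gamma>) u" if "u \<in> {a<..<b}" for u
        using cc.trans_crd[of "\<gamma> u"] c'ab that by (auto simp: image_subset_iff)
      ultimately have "((crd c \<circ> \<gamma>) has_derivative dtrans c' c (\<gamma> t) \<circ> (\<lambda>h. h *\<^sub>R D t)) (at t)"
        using t by (elim has_derivative_transform_within_open[where s = "{a<..<b}"]) auto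
      thus "((crd c \<circ> \<gamma>) has_vector_derivative dtrans c' c (\<gamma> t) (D t)) (at t)"
        unfolding has_vector_derivative_def using linear_cmul[OF cc.linear_dtrans[OF dom]] by (simp add: o_def)
      show "norm (dtrans c' c (\<gamma> t) (D t)) \<le> K * ?s t"
        using K(2)[of "\<gamma> t" "dtrans c' c (\<gamma> t) (D t)"] t cc.metric_coord_change[OF dom] by simp
    qed
    thus ?thesis by simp
  qed
qed

text \<open>The path has to lie in \<open>N\<close> only up to time \<open>s\<close>, while
  \<open>l\<close> is its total length. The exit-time argument needs this form, which assumes
  nothing about the position of the path after \<open>s\<close>.\<close>

lemma increment_le_length:
  assumes A: "smooth_atlas A" and g: "riemannian_metric A g" and c: "c \<in> A"
    and len: "has_riemannian_length A g \<gamma> l"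
    and s: "s \<in> {0..1}" "\<gamma> ` {0..s} \<subseteq> N" "N \<subseteq> chart_dom c"
    and K: "K \<ge> 0" "\<And>q v. q \<in> N \<Longrightarrow> norm v \<le> K * sqrt (metric_coord g c (crd c q) v v)"
  shows "norm (crd c (\<gamma> s) - crd c (\<gamma> 0)) \<le> K * l"
proof -
  obtain n \<tau> cc D where \<gamma>: "path \<gamma>" and sub: "chart_subdivision A \<gamma> n \<tau> cc"
    and D: "\<And>i. i < n \<Longrightarrow> continuous_on {\<tau> i..\<tau> (Suc i)} (D i)"
      "\<And>i t. i < n \<Longrightarrow> t \<in> {\<tau> i..\<tau> (Suc i)} \<Longrightarrow>
        ((crd (cc i) \<circ> \<gamma>) has_vector_derivative D i t) (at t within {\<tau> i..\<tau> (Suc i)})"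
    and l: "l = (\<Sum>i<n. integral {\<tau> i..\<tau> (Suc i)}
      (\<lambda>t. sqrt (metric_coord g (cc i) (crd (cc i) (\<gamma> t)) (D i t) (D i t))))"
    using len unfolding has_riemannian_length_def by blast
  have \<tau>: "\<tau> 0 = 0" "\<tau> n = 1" "\<And>i. i < n \<Longrightarrow> \<tau> i < \<tau> (Suc i)" "\<And>i. i < n \<Longrightarrow> cc i \<in> A"
    "\<And>i. i < n \<Longrightarrow> \<gamma> ` {\<tau> i..\<tau> (Suc i)} \<subseteq> chart_dom (cc i)"
    using sub unfolding chart_subdivision_def by auto
  define sp where "sp i t = sqrt (metric_coord g (cc i) (crd (cc i) (\<gamma> t)) (D i t) (D i t))" for i t
  have mono: "\<tau> i \<le> \<tau> j" if "i \<le> j" "j \<le> n" for i j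
    using that by (induction j) (auto simp: le_Suc_eq intro: order_trans[OF _ less_imp_le[OF \<tau>(3)]])
  have sp: "sp i t \<ge> 0" if "i < n" "t \<in> {\<tau> i..\<tau> (Suc i)}" for i t
    unfolding sp_def using that \<tau>(4,5) metric_coord_nonneg[OF g] by (simp add: image_subset_iff)
  \<comment> \<open>The time \<open>u\<close> may fall inside a piece: the speed is non-negative, so
    the length up to \<open>u\<close> is at most that of the whole piece.\<close>
  have piece: "norm (crd c (\<gamma> u) - crd c (\<gamma> (\<tau> i))) \<le> K * integral {\<tau> i..\<tau> (Suc i)} (sp i)"
    if i: "i < n" and u: "u \<in> {\<tau> i..\<tau> (Suc i)}" "u \<le> s" for i u
  proof -
    have ss: "{\<tau> i..u} \<subseteq> {\<tau> i..\<tau> (Suc i)}" "{\<tau> i..\<tau> (Suc i)} \<subseteq> {0..1}"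
      using u \<tau>(1,2) mono[of 0 i] mono[of "Suc i" n] i by auto
    have N: "\<gamma> ` {\<tau> i..u} \<subseteq> N" using s(2) u ss by force
    have cont: "continuous_on {0..1} \<gamma>" using \<gamma> unfolding path_def .
    have 1: "norm (crd c (\<gamma> u) - crd c (\<gamma> (\<tau> i))) \<le> K * integral {\<tau> i..u} (sp i)"
      unfolding sp_def
    proof (rule increment_le_length_piece[OF A g c \<tau>(4)[OF i]])
      show "continuous_on {\<tau> i..u} \<gamma>" "continuous_on {\<tau> i..u} (D i)"
        using cont D(1)[OF i] ss by (meson continuous_on_subset order_trans)+
      show "((crd (cc i) \<circ> \<gamma>) has_vector_derivative D i t) (at t within {\<tau> i..u})" if "t \<in> {\<tau> i..u}" for t
        using D(2)[OF i, of t] that ss(1) has_vector_derivative_within_subset by blast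
    qed (use N s(3) K \<tau>(5)[OF i] ss(1) u in auto)
    have "continuous_on {\<tau> i..\<tau> (Suc i)} (sp i)"
      unfolding sp_def
    proof (rule continuous_on_speed[OF g \<tau>(4)[OF i] _ _ \<tau>(5)[OF i] D(1)[OF i]])
      show "is_chart (cc i)" using A \<tau>(4)[OF i] unfolding smooth_atlas_def by blast
      show "continuous_on {\<tau> i..\<tau> (Suc i)} \<gamma>" using cont ss(2) continuous_on_subset by blast
    qed
    hence "integral {\<tau> i..u} (sp i) \<le> integral {\<tau> i..\<tau> (Suc i)} (sp i)"
      using ss sp[OF i] by (intro integral_subset_le integrable_continuous_real) (auto intro: continuous_on_subset)
    thus ?thesis using 1 K(1) by (meson mult_left_mono order_trans)
  qed
  have "norm (crd c (\<gamma> u) - crd c (\<gamma> 0)) \<le> K * (\<Sum>j<i. integral {\<tau> j..\<tau> (Suc j)} (sp j))"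
    if "i \<le> n" "u \<in> {0..\<tau> i}" "u \<le> s" for i u
    using that
  proof (induction i arbitrary: u)
    case 0
    then show ?case using \<tau>(1) by simp
  next
    case (Suc i)
    have i: "i < n" "i \<le> n" using Suc.prems by auto
    show ?case
    proof (cases "u \<le> \<tau> i")
      case True
      \<comment> \<open>A non-integrable function has integral 0 by default, so non-negativity of
        the speed suffices here.\<close>
      have "0 \<le> integral {\<tau> i..\<tau> (Suc i)} (sp i)"
        using sp[OF i(1)] by (cases "sp i integrable_on {\<tau> i..\<tau> (Suc i)}")
          (auto intro!: integral_nonneg simp: not_integrable_integral)
      with Suc.IH[of u] True Suc.prems i K(1) show ?thesis
        by (simp add: distrib_left add_increasing2)
    next
      case False
      have "norm (crd c (\<gamma> u) - crd c (\<gamma> 0)) \<le>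
        norm (crd c (\<gamma> u) - crd c (\<gamma> (\<tau> i))) + norm (crd c (\<gamma> (\<tau> i)) - crd c (\<gamma> 0))"
        using norm_triangle_ineq[of "crd c (\<gamma> u) - crd c (\<gamma> (\<tau> i))"
          "crd c (\<gamma> (\<tau> i)) - crd c (\<gamma> 0)"] by simp
      with Suc.IH[of "\<tau> i"] piece[OF i(1), of u] False Suc.prems i mono[of 0 i] \<tau>(1) show ?thesis
        by (simp add: distrib_left)
    qed
  qed
  from this[of n s] show ?thesis using s(1) \<tau>(2) unfolding l sp_def by simp
qed

text \<open>
  Up to its first exit time from the ball a short path stays in a smaller compact ball, whose
  preimage in \<open>M\<close> is closed because \<open>M\<close> is Hausdorff; so there is no exit time.
\<close>

lemma stays_in_chart_ball:
  fixes A :: "'a::t2_space chart set"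
  assumes A: "smooth_atlas A" and g: "riemannian_metric A g" and c: "c \<in> A"
    and \<rho>: "\<rho> > 0" "cball x \<rho> \<subseteq> crd c ` chart_dom c"
    and K: "K > 0" "\<And>y v. y \<in> cball x \<rho> \<Longrightarrow> norm v \<le> K * sqrt (metric_coord g c y v v)"
    and len: "has_riemannian_length A g \<gamma> l"
    and start: "pathstart \<gamma> \<in> chart_dom c" "crd c (pathstart \<gamma>) \<in> ball x (\<rho> / 2)" and l: "K * l < \<rho> / 2"
  shows "\<gamma> ` {0..1} \<subseteq> chart_dom c \<inter> crd c -` ball x \<rho>"
proof (rule ccontr)
  have chart: "is_chart c" using A c unfolding smooth_atlas_def by blast
  let ?N = "chart_dom c \<inter> crd c -` ball x \<rho>"
  define E where "E = {t\<in>{0..1}. \<gamma> t \<notin> ?N}"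
  assume "\<not> \<gamma> ` {0..1} \<subseteq> ?N"
  hence E: "E \<noteq> {}" unfolding E_def by blast
  have \<gamma>: "continuous_on {0..1} \<gamma>" using len unfolding has_riemannian_length_def path_def by blast
  have "closed E"
  proof -
    have "closed ({0..1} \<inter> \<gamma> -` (- ?N))"
      by (intro continuous_closed_preimage[OF \<gamma>] closed_Compl open_chart_preimage[OF chart open_ball])
        (rule closed_atLeastAtMost)
    moreover have "{0..1} \<inter> \<gamma> -` (- ?N) = E" unfolding E_def by auto
    ultimately show ?thesis by simp
  qed
  define T where "T = Inf E"
  have bdd: "bdd_below E" unfolding E_def by (rule bdd_belowI[of _ 0]) auto
  have TE: "T \<in> E" unfolding T_def by (rule closed_contains_Inf[OF E bdd \<open>closed E\<close>])
  have before: "\<gamma> t \<in> ?N" if "0 \<le> t" "t < T" for t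
  proof (rule ccontr)
    assume "\<gamma> t \<notin> ?N"
    hence "t \<in> E" using that TE unfolding E_def by auto
    thus False using cInf_lower[OF _ bdd] that unfolding T_def by force
  qed
  have "\<gamma> 0 \<in> ?N" using start \<rho>(1) unfolding pathstart_def by auto
  hence T: "0 < T" "T \<le> 1" using TE unfolding E_def by (auto simp: less_le)
  \<comment> \<open>The start is less than \<open>\<rho> / 2\<close> away from \<open>x\<close>, and
    \<open>K * l\<close> is below \<open>\<rho> / 2\<close>; this radius is thus strictly less than
    \<rho>.\<close>
  define \<rho>' where "\<rho>' = dist x (crd c (\<gamma> 0)) + K * l"
  have \<rho>': "\<rho>' < \<rho>" using start(2) l unfolding \<rho>'_def pathstart_def by simp
  define C where "C = crd_inv c ` cball x \<rho>'"
  have sub: "cball x \<rho>' \<subseteq> crd c ` chart_dom c" using \<rho>(2) \<rho>' by force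
  have "compact C" unfolding C_def
    using chartD(4)[OF chart] sub by (intro compact_continuous_image) (auto intro: continuous_on_subset)
  hence "closed C" by (rule compact_imp_closed)
  hence cl: "closed ({0..1} \<inter> \<gamma> -` C)" by (intro continuous_closed_preimage \<gamma>) auto
  have CN: "C \<subseteq> ?N"
  proof
    fix q assume "q \<in> C"
    then obtain y where y: "y \<in> cball x \<rho>'" "q = crd_inv c y" unfolding C_def by blast
    thus "q \<in> ?N" using chartD(7,8)[OF chart, of y] sub \<rho>' by auto
  qed
  have "\<gamma> t \<in> C" if t: "0 \<le> t" "t < T" for t
  proof -
    have "norm (crd c (\<gamma> t) - crd c (\<gamma> 0)) \<le> K * l"
      by (rule increment_le_length[OF A g c len, where N = ?N])
        (use t T before K in auto)
    hence "dist x (crd c (\<gamma> t)) \<le> \<rho>'"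
      unfolding \<rho>'_def using dist_triangle[of x "crd c (\<gamma> t)" "crd c (\<gamma> 0)"]
      by (simp add: dist_norm norm_minus_commute)
    thus ?thesis unfolding C_def using before[OF t] chartD(6)[OF chart]
      by (intro image_eqI[of _ _ "crd c (\<gamma> t)"]) auto
  qed
  hence "{0..<T} \<subseteq> {0..1} \<inter> \<gamma> -` C" using T by auto
  hence "closure {0..<T} \<subseteq> {0..1} \<inter> \<gamma> -` C" using cl by (rule closure_minimal)
  moreover have "T \<in> closure {0..<T}" using T by simp
  ultimately have "\<gamma> T \<in> C" by blast
  thus False using CN TE unfolding E_def by blast
qed

text \<open>The radius \<open>r / 4\<close> makes the infimum over all paths harmless: two points
  there are at most \<open>r / 2\<close> apart, so a path with \<open>K * l\<close> at least
  \<open>r / 2\<close> satisfies the lower bound trivially, and a shorter one stays in the ball of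
  radius \<open>r\<close>. The upper bound comes from coordinate segments. In the first comparison,
  membership of \<open>q'\<close> in the chart is a conclusion, since subarcs of \<open>L\<close>
  are not known in advance to stay there.\<close>

lemma riemannian_dist_chart_bounds:
  fixes A :: "'a::t2_space chart set"
  assumes A: "smooth_atlas A" and g: "riemannian_metric A g" and c: "c \<in> A" and p: "p \<in> chart_dom c"
  obtains K r where "K > 0" "r > 0" "cball (crd c p) r \<subseteq> crd c ` chart_dom c"
    "\<And>\<rho> q q'. 0 < \<rho> \<Longrightarrow> \<rho> \<le> r \<Longrightarrow> q \<in> chart_dom c \<Longrightarrow> crd c q \<in> ball (crd c p) (\<rho> / 2) \<Longrightarrow>
       riemannian_dist A g q q' < ennreal (\<rho> / (2 * K)) \<Longrightarrow> q' \<in> chart_dom c \<and> crd c q' \<in> ball (crd c p) \<rho>"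
    "\<And>q q'. q \<in> chart_dom c \<Longrightarrow> q' \<in> chart_dom c \<Longrightarrow>
       crd c q \<in> ball (crd c p) (r / 4) \<Longrightarrow> crd c q' \<in> ball (crd c p) (r / 4) \<Longrightarrow>
       ennreal (norm (crd c q' - crd c q)) \<le> ennreal K * riemannian_dist A g q q'"
    "\<And>q q'. q \<in> chart_dom c \<Longrightarrow> q' \<in> chart_dom c \<Longrightarrow>
       crd c q \<in> ball (crd c p) r \<Longrightarrow> crd c q' \<in> ball (crd c p) r \<Longrightarrow>
       riemannian_dist A g q q' \<le> ennreal (K * norm (crd c q' - crd c q))"
proof -
  have chart: "is_chart c" using A c unfolding smooth_atlas_def by blast
  obtain r where r: "r > 0" "cball (crd c p) r \<subseteq> crd c ` chart_dom c"
    using chartD(2)[OF chart] p open_contains_cball by blast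
  obtain K where K: "K > 0"
    "\<And>x v. x \<in> cball (crd c p) r \<Longrightarrow> norm v \<le> K * sqrt (metric_coord g c x v v)"
    "\<And>x v. x \<in> cball (crd c p) r \<Longrightarrow> sqrt (metric_coord g c x v v) \<le> K * norm v"
    using metric_coord_bounds[OF g c compact_cball r(2)] by blast
  let ?S = "\<lambda>q q'. {ennreal l |l. \<exists>\<gamma>. has_riemannian_length A g \<gamma> l \<and> pathstart \<gamma> = q \<and> pathfinish \<gamma> = q'}"
  have stay: "\<gamma> ` {0..1} \<subseteq> chart_dom c \<inter> crd c -` ball (crd c p) \<rho>"
    if "0 < \<rho>" "\<rho> \<le> r" "pathstart \<gamma> \<in> chart_dom c" "crd c (pathstart \<gamma>) \<in> ball (crd c p) (\<rho> / 2)"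
      "has_riemannian_length A g \<gamma> l" "K * l < \<rho> / 2" for \<rho> \<gamma> l
  proof (rule stays_in_chart_ball[OF A g c that(1) _ K(1) _ that(5,3,4,6)])
    show "cball (crd c p) \<rho> \<subseteq> crd c ` chart_dom c" using r(2) that(2) by force
    show "norm v \<le> K * sqrt (metric_coord g c y v v)" if "y \<in> cball (crd c p) \<rho>" for y v
      using K(2)[of y v] that \<open>\<rho> \<le> r\<close> by simp
  qed
  show thesis
  proof (rule that[OF K(1) r])
    fix \<rho> q q'
    assume \<rho>: "0 < \<rho>" "\<rho> \<le> r" and q: "q \<in> chart_dom c" "crd c q \<in> ball (crd c p) (\<rho> / 2)"
      and d: "riemannian_dist A g q q' < ennreal (\<rho> / (2 * K))"
    obtain l \<gamma> where \<gamma>: "has_riemannian_length A g \<gamma> l" "pathstart \<gamma> = q" "pathfinish \<gamma> = q'"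
      and l: "ennreal l < ennreal (\<rho> / (2 * K))"
      using d unfolding riemannian_dist_def Inf_less_iff by blast
    have "l < \<rho> / (2 * K)" using l \<rho>(1) K(1) by (metis ennreal_leI leD linorder_not_less)
    hence "K * l < \<rho> / 2" using K(1) by (simp add: field_simps)
    hence "\<gamma> ` {0..1} \<subseteq> chart_dom c \<inter> crd c -` ball (crd c p) \<rho>"
      using \<gamma> q by (intro stay[OF \<rho>]) auto
    thus "q' \<in> chart_dom c \<and> crd c q' \<in> ball (crd c p) \<rho>"
      using \<gamma>(3) unfolding pathfinish_def by (auto simp: image_subset_iff)
  next
    fix q q'
    assume q: "q \<in> chart_dom c" "q' \<in> chart_dom c"
      "crd c q \<in> ball (crd c p) (r / 4)" "crd c q' \<in> ball (crd c p) (r / 4)"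
    have "dist (crd c q') (crd c q) \<le> r / 4 + r / 4"
      using q by (intro dist_triangle_le[where z = "crd c p"]) (auto simp: dist_commute)
    hence small: "norm (crd c q' - crd c q) \<le> r / 2" by (simp add: dist_norm)
    have "ennreal (norm (crd c q' - crd c q) / K) \<le> riemannian_dist A g q q'"
      unfolding riemannian_dist_def
    proof (rule Inf_greatest, clarify)
      fix l \<gamma> assume \<gamma>: "has_riemannian_length A g \<gamma> l" "q = pathstart \<gamma>" "q' = pathfinish \<gamma>"
      have "norm (crd c q' - crd c q) \<le> K * l"
      proof (cases "K * l < r / 2")
        case True
        have st: "\<gamma> ` {0..1} \<subseteq> chart_dom c \<inter> crd c -` ball (crd c p) r"
          by (rule stay[OF r(1) order_refl _ _ \<gamma>(1) True]) (use q \<gamma> r in auto)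
        show ?thesis
          unfolding \<gamma>(2,3) pathstart_def pathfinish_def
          by (rule increment_le_length[OF A g c \<gamma>(1) _ st]) (use K in auto)
      qed (use small in simp)
      thus "ennreal (norm (crd c (pathfinish \<gamma>) - crd c (pathstart \<gamma>)) / K) \<le> ennreal l"
        using K(1) \<gamma>(2,3) by (intro ennreal_leI) (simp add: divide_le_eq mult.commute)
    qed
    hence "ennreal K * ennreal (norm (crd c q' - crd c q) / K) \<le> ennreal K * riemannian_dist A g q q'"
      by (rule mult_left_mono) simp
    thus "ennreal (norm (crd c q' - crd c q)) \<le> ennreal K * riemannian_dist A g q q'"
      using K(1) by (simp flip: ennreal_mult)
  next
    fix q q'
    assume q: "q \<in> chart_dom c" "q' \<in> chart_dom c"
      "crd c q \<in> ball (crd c p) r" "crd c q' \<in> ball (crd c p) r"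
    let ?v = "crd c q' - crd c q"
    \<comment> \<open>Preimage of the coordinate segment; it has a single piece, with breakpoints
      \<open>real 0\<close> and \<open>real 1\<close> and constant velocity
      \<open>?v\<close>.\<close>
    define \<gamma> where "\<gamma> = crd_inv c \<circ> linepath (crd c q) (crd c q')"
    have seg: "linepath (crd c q) (crd c q') t \<in> ball (crd c p) r" if "t \<in> {0..1}" for t
      using closed_segment_subset[OF q(3,4) convex_ball] linepath_in_path that by blast
    hence dom: "linepath (crd c q) (crd c q') t \<in> crd c ` chart_dom c" if "t \<in> {0..1}" for t
      using that r(2) ball_subset_cball by blast
    have crd_\<gamma>: "crd c (\<gamma> t) = linepath (crd c q) (crd c q') t" "\<gamma> t \<in> chart_dom c" if "t \<in> {0..1}" for t
      unfolding \<gamma>_def using chartD(7,8)[OF chart dom[OF that]] by simp_all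
    have ends: "pathstart \<gamma> = q" "pathfinish \<gamma> = q'"
      unfolding \<gamma>_def pathstart_def pathfinish_def using chartD(6)[OF chart] q by (simp_all add: linepath_def)
    have path: "path \<gamma>"
      unfolding \<gamma>_def path_def using dom
      by (intro continuous_on_compose continuous_on_linepath continuous_on_subset[OF chartD(4)[OF chart]]) auto
    let ?I = "integral {0..1} (\<lambda>t. sqrt (metric_coord g c (crd c (\<gamma> t)) ?v ?v))"
    have len: "has_riemannian_length A g \<gamma> ?I"
      unfolding has_riemannian_length_def
    proof (intro conjI path exI)
      show "chart_subdivision A \<gamma> 1 real (\<lambda>_. c)"
        unfolding chart_subdivision_def using c crd_\<gamma>(2) by auto
      show "\<forall>i<1. continuous_on {real i..real (Suc i)} ((\<lambda>_ _. ?v) i) \<and>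
        (\<forall>t\<in>{real i..real (Suc i)}. ((crd ((\<lambda>_. c) i) \<circ> \<gamma>) has_vector_derivative (\<lambda>_ _. ?v) i t)
          (at t within {real i..real (Suc i)}))"
      proof (intro allI impI conjI ballI)
        fix i t assume i: "i < (1::nat)" and t: "t \<in> {real i..real (Suc i)}"
        have "(linepath (crd c q) (crd c q') has_vector_derivative ?v) (at t within {0..1})"
          by (rule has_vector_derivative_linepath_within)
        hence "((crd c \<circ> \<gamma>) has_vector_derivative ?v) (at t within {0..1})"
          by (rule has_vector_derivative_transform[rotated 2]) (use i t crd_\<gamma>(1) in auto)
        thus "((crd c \<circ> \<gamma>) has_vector_derivative ?v) (at t within {real i..real (Suc i)})"
          using i by simp
      qed auto
      show "?I = (\<Sum>i<1. integral {real i..real (Suc i)}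
        (\<lambda>t. sqrt (metric_coord g ((\<lambda>_. c) i) (crd ((\<lambda>_. c) i) (\<gamma> t)) ((\<lambda>_ _. ?v) i t) ((\<lambda>_ _. ?v) i t))))"
        by simp
    qed
    have "?I \<le> integral {0..1::real} (\<lambda>_. K * norm ?v)"
    proof (rule integral_le)
      show "(\<lambda>t. sqrt (metric_coord g c (crd c (\<gamma> t)) ?v ?v)) integrable_on {0..1}"
        using path crd_\<gamma>(2) unfolding path_def
        by (intro integrable_continuous_real continuous_on_speed[OF g c chart]) auto
      show "sqrt (metric_coord g c (crd c (\<gamma> t)) ?v ?v) \<le> K * norm ?v" if "t \<in> {0..1}" for t
        using K(3)[of "crd c (\<gamma> t)" ?v] seg[OF that] crd_\<gamma>(1)[OF that] by auto
    qed auto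
    hence I: "?I \<le> K * norm ?v" by simp
    have "riemannian_dist A g q q' \<le> ennreal ?I"
      unfolding riemannian_dist_def using len ends by (intro Inf_lower) blast
    also have "\<dots> \<le> ennreal (K * norm ?v)" by (rule ennreal_leI[OF I])
    finally show "riemannian_dist A g q q' \<le> ennreal (K * norm ?v)" .
  qed
qed

section \<open>Length and variation along curves\<close>

text \<open>\<open>arc\<close> refers to paths on the unit interval; an affine change of parameter
  makes restrictions to subintervals available as arcs.\<close>

lemma arc_reparametrization:
  fixes h :: "real \<Rightarrow> 'a::topological_space"
  assumes "u < v" "continuous_on {u..v} h" "inj_on h {u..v}"
  obtains g where "arc g" "path_image g = h ` {u..v}" "pathstart g = h u" "pathfinish g = h v"
proof
  let ?l = "linepath u v"
  have im: "?l ` {0..1} = {u..v}"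
    using assms(1) linepath_image_01[of u v] by (simp add: closed_segment_eq_real_ivl)
  show "arc (h \<circ> ?l)"
    unfolding arc_def path_def
  proof
    show "continuous_on {0..1} (h \<circ> ?l)"
      using assms(2) im by (intro continuous_on_compose continuous_on_linepath) simp
    show "inj_on (h \<circ> ?l) {0..1}"
      using assms(1,3) im by (intro comp_inj_on) (simp_all add: inj_on_linepath)
  qed
  show "path_image (h \<circ> ?l) = h ` {u..v}"
    unfolding path_image_def image_comp[symmetric] im ..
  show "pathstart (h \<circ> ?l) = h u" "pathfinish (h \<circ> ?l) = h v"
    by (simp_all add: pathstart_def pathfinish_def linepath_def)
qed

text \<open>\<open>arc_boundary\<close> collects the endpoints of all parametrizations of a set;
  that it contains the two given ones is enough for the inequality.\<close>

lemma diam_arc_boundary_ge: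
  fixes h :: "real \<Rightarrow> 'a::topological_space"
  assumes "u < v" "continuous_on {u..v} h" "inj_on h {u..v}"
  shows "d (h u) (h v) \<le> diam d (arc_boundary (h ` {u..v}))"
    and "{h u, h v} \<subseteq> arc_boundary (h ` {u..v})"
proof -
  show ends: "{h u, h v} \<subseteq> arc_boundary (h ` {u..v})"
    by (rule arc_reparametrization[OF assms]) (auto simp: arc_boundary_def)
  thus "d (h u) (h v) \<le> diam d (arc_boundary (h ` {u..v}))"
    unfolding diam_def by (intro SUP_upper2[of "h u"] SUP_upper) auto
qed

text \<open>The images of the intervals of a division form a decomposition into subarcs, over which
  the length is a supremum. Degenerate intervals are discarded because their images are points, not
  arcs.\<close>

lemma curve_length_ge_division:
  fixes h :: "real \<Rightarrow> 'a::topological_space"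
  assumes "a < b" "continuous_on {a..b} h" "inj_on h {a..b}" "\<D> division_of {a..b}"
  shows "(\<Sum>K\<in>{K\<in>\<D>. Inf K < Sup K}. d (h (Inf K)) (h (Sup K))) \<le> curve_length d (h ` {a..b})"
proof -
  define E where "E = {K\<in>\<D>. Inf K < Sup K}"
  have "{K\<in>\<D>. measure lborel K \<noteq> 0} division_of {a..b}"
    using division_of_nontrivial[of \<D> a b] assms(1,4) by simp
  moreover have "{K\<in>\<D>. measure lborel K \<noteq> 0} = E"
  proof -
    have "measure lborel K \<noteq> 0 \<longleftrightarrow> Inf K < Sup K" if KD: "K \<in> \<D>" for K
    proof -
      obtain u v where "K = {u..v}" "u \<le> v"
        using division_ofD(3,4)[OF assms(4) KD] by (metis atLeastatMost_empty_iff box_real(2))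
      thus ?thesis by (auto simp: less_le)
    qed
    thus ?thesis unfolding E_def by blast
  qed
  ultimately have E: "E division_of {a..b}" by simp
  have K: "\<exists>u v. u < v \<and> K = {u..v} \<and> {u..v} \<subseteq> {a..b}" if KE: "K \<in> E" for K
  proof -
    obtain u v where uv: "K = {u..v}" "u \<le> v"
      using division_ofD(3,4)[OF E KE] by (metis atLeastatMost_empty_iff box_real(2))
    hence "u < v" using KE unfolding E_def by auto
    thus ?thesis using uv division_ofD(2)[OF E KE] by auto
  qed
  have img: "inj_on ((`) h) E"
  proof (rule inj_onI)
    fix K K' assume "K \<in> E" "K' \<in> E" "h ` K = h ` K'"
    thus "K = K'" using inj_on_image_eq_iff[OF assms(3)] division_ofD(2)[OF E] by blast
  qed
  have KE: "continuous_on {u..v} h" "inj_on h {u..v}" if "{u..v} \<subseteq> {a..b}" for u v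
    using that assms(2,3) continuous_on_subset inj_on_subset by blast+
  have dec: "subarc_decomposition (h ` {a..b}) ((`) h ` E)"
    unfolding subarc_decomposition_def
  proof (intro conjI ballI)
    fix \<gamma> assume "\<gamma> \<in> (`) h ` E"
    then obtain u v where uv: "u < v" "\<gamma> = h ` {u..v}" "{u..v} \<subseteq> {a..b}" using K by blast
    show "compact_subarc (h ` {a..b}) \<gamma>"
      unfolding compact_subarc_def using uv arc_reparametrization[OF uv(1) KE[OF uv(3)]] by blast
  next
    show "\<Union> ((`) h ` E) = h ` {a..b}" using division_ofD(6)[OF E] by blast
    show "pairwise (\<lambda>\<gamma> \<gamma>'. (\<gamma> - arc_boundary \<gamma>) \<inter> (\<gamma>' - arc_boundary \<gamma>') = {}) ((`) h ` E)"
    proof (rule pairwiseI)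
      fix \<gamma> \<gamma>' assume g: "\<gamma> \<in> (`) h ` E" "\<gamma>' \<in> (`) h ` E" "\<gamma> \<noteq> \<gamma>'"
      then obtain k k' where k: "k \<in> E" "\<gamma> = h ` k" "k' \<in> E" "\<gamma>' = h ` k'" "k \<noteq> k'" by blast
      \<comment> \<open>Without its boundary points an arc lies in the image of the open interval;
        injectivity of \<open>h\<close> then carries disjointness of the interiors over to the
        arcs.\<close>
      have inner: "\<exists>S\<subseteq>interior k. h ` k - arc_boundary (h ` k) \<subseteq> h ` S" if kE: "k \<in> E" for k
      proof -
        obtain u v where uv: "u < v" "k = {u..v}" "{u..v} \<subseteq> {a..b}" using K[OF kE] by blast
        have "h ` k - arc_boundary (h ` k) \<subseteq> h ` {u<..<v}"
        proof
          fix y assume y: "y \<in> h ` k - arc_boundary (h ` k)"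
          then obtain t where t: "t \<in> {u..v}" "y = h t" using uv by blast
          have "t \<noteq> u" "t \<noteq> v"
            using y t diam_arc_boundary_ge(2)[OF uv(1) KE[OF uv(3)]] uv(2) by auto
          thus "y \<in> h ` {u<..<v}" using t by auto
        qed
        thus ?thesis using uv by (intro exI[of _ "{u<..<v}"]) simp
      qed
      have "interior k \<inter> interior k' = {}" using division_ofD(5)[OF E k(1,3,5)] .
      moreover have "interior k \<subseteq> {a..b}" "interior k' \<subseteq> {a..b}"
        using division_ofD(2)[OF E] k interior_subset by blast+
      ultimately have "h ` interior k \<inter> h ` interior k' = {}"
        using inj_on_image_Int[OF assms(3)] by (metis image_empty)
      thus "(\<gamma> - arc_boundary \<gamma>) \<inter> (\<gamma>' - arc_boundary \<gamma>') = {}"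
        using inner[OF k(1)] inner[OF k(3)] k by blast
    qed
  qed
  have "(\<Sum>K\<in>E. d (h (Inf K)) (h (Sup K))) \<le> (\<Sum>K\<in>E. diam d (arc_boundary (h ` K)))"
  proof (rule sum_mono)
    fix k assume "k \<in> E"
    then obtain u v where uv: "u < v" "k = {u..v}" "{u..v} \<subseteq> {a..b}" using K by blast
    thus "d (h (Inf k)) (h (Sup k)) \<le> diam d (arc_boundary (h ` k))"
      using diam_arc_boundary_ge(1)[OF uv(1) KE[OF uv(3)]] by simp
  qed
  also have "\<dots> = (\<Sum>\<gamma>\<in>(`) h ` E. diam d (arc_boundary \<gamma>))"
    by (subst sum.reindex[OF img]) simp
  also have "\<dots> = (\<Sum>\<^sub>\<infinity>\<gamma>\<in>(`) h ` E. diam d (arc_boundary \<gamma>))"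
    using division_ofD(1)[OF E] by (simp add: infsum_finite)
  also have "\<dots> \<le> curve_length d (h ` {a..b})"
    unfolding curve_length_def using dec by (intro SUP_upper) simp
  finally show ?thesis unfolding E_def .
qed

text \<open>Cutting the arc at \<open>t\<close> gives a division in which the part up to
  \<open>t\<close> already contributes the distance. This later confines a short subarc to a
  neighborhood of its start.\<close>

lemma curve_length_ge_dist_start:
  fixes h :: "real \<Rightarrow> 'a::topological_space"
  assumes "arc h" "t \<in> {0<..1}"
  shows "d (pathstart h) (h t) \<le> curve_length d (path_image h)"
proof -
  have h: "continuous_on {0..1} h" "inj_on h {0..1}"
    using assms(1) unfolding arc_def path_def by auto
  let ?D = "if t = 1 then {{0..1}} else {{0..t}, {t..1::real}}"
  have D: "?D division_of {0..1}"
  proof (cases "t = 1")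
    case False
    have self: "{{u..v}} division_of {u..v}" if "u \<le> v" for u v :: real
      using that division_of_self[of u v] by simp
    have "{{0..t}} \<union> {{t..1}} division_of {0..t} \<union> {t..1}"
      using assms(2) by (intro division_disjoint_union self) auto
    moreover have "{0..t} \<union> {t..1} = {0..1}" using assms(2) by auto
    ultimately show ?thesis using False by (simp add: insert_commute)
  qed (use division_of_self[of 0 "1::real"] in simp)
  have fin: "finite {K\<in>?D. Inf K < Sup K}" by simp
  have "d (h 0) (h t) = (\<Sum>K\<in>{{0..t}}. d (h (Inf K)) (h (Sup K)))" using assms(2) by simp
  also have "\<dots> \<le> (\<Sum>K\<in>{K\<in>?D. Inf K < Sup K}. d (h (Inf K)) (h (Sup K)))"
    using assms(2) by (intro sum_mono2[OF fin]) auto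
  also have "\<dots> \<le> curve_length d (h ` {0..1})"
    by (rule curve_length_ge_division[OF _ h D]) simp
  finally show ?thesis by (simp add: pathstart_def path_image_def)
qed

text \<open>Each increment is compared with a distance between two points of the curve, and these
  distances sum to at most the length. Degenerate intervals contribute 0 to the variation, which
  matches their absence from decompositions.\<close>

lemma variation_le_curve_length:
  fixes h :: "real \<Rightarrow> 'a::topological_space" and x :: "real \<Rightarrow> 'b::real_normed_vector"
  assumes h: "a < b" "continuous_on {a..b} h" "inj_on h {a..b}" and \<D>: "\<D> division_of {a..b}"
    and bound: "\<And>t t'. t \<in> {a..b} \<Longrightarrow> t' \<in> {a..b} \<Longrightarrow> ennreal (norm (x t' - x t)) \<le> ennreal K * d (h t) (h t')"
  shows "ennreal (\<Sum>k\<in>\<D>. norm (x (Sup k) - x (Inf k))) \<le> ennreal K * curve_length d (h ` {a..b})"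
proof -
  let ?E = "{k\<in>\<D>. Inf k < Sup k}"
  have k: "\<exists>u v. k = {u..v} \<and> u \<le> v \<and> u \<in> {a..b} \<and> v \<in> {a..b}" if kD: "k \<in> \<D>" for k
  proof -
    obtain u v where "k = {u..v}" "u \<le> v"
      using division_ofD(3,4)[OF \<D> kD] by (metis atLeastatMost_empty_iff box_real(2))
    thus ?thesis using division_ofD(2)[OF \<D> kD] by auto
  qed
  have "(\<Sum>k\<in>\<D>. norm (x (Sup k) - x (Inf k))) = (\<Sum>k\<in>?E. norm (x (Sup k) - x (Inf k)))"
  proof (rule sum.mono_neutral_right)
    show "\<forall>k\<in>\<D> - ?E. norm (x (Sup k) - x (Inf k)) = 0"
    proof
      fix k assume "k \<in> \<D> - ?E"
      moreover from this obtain u v where "k = {u..v}" "u \<le> v" using k by blast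
      ultimately show "norm (x (Sup k) - x (Inf k)) = 0" by auto
    qed
  qed (use division_ofD(1)[OF \<D>] in auto)
  hence "ennreal (\<Sum>k\<in>\<D>. norm (x (Sup k) - x (Inf k))) = (\<Sum>k\<in>?E. ennreal (norm (x (Sup k) - x (Inf k))))"
    by simp
  also have "\<dots> \<le> (\<Sum>k\<in>?E. ennreal K * d (h (Inf k)) (h (Sup k)))"
  proof (rule sum_mono)
    fix k assume "k \<in> ?E"
    then obtain u v where "k = {u..v}" "u \<le> v" "u \<in> {a..b}" "v \<in> {a..b}" using k by blast
    thus "ennreal (norm (x (Sup k) - x (Inf k))) \<le> ennreal K * d (h (Inf k)) (h (Sup k))"
      using bound by simp
  qed
  also have "\<dots> = ennreal K * (\<Sum>k\<in>?E. d (h (Inf k)) (h (Sup k)))" by (simp add: sum_distrib_left)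
  also have "\<dots> \<le> ennreal K * curve_length d (h ` {a..b})"
    by (intro mult_left_mono curve_length_ge_division[OF h \<D>]) simp
  finally show ?thesis .
qed

text \<open>Tagged divisions of consecutive intervals combine to one division of the union. Being a
  set, it counts an interval once even if it occurs with several tags or in two of the divisions;
  such intervals have empty interior, and \<open>F\<close> vanishes on them.\<close>

lemma sum_over_subdivision:
  fixes F :: "real set \<Rightarrow> real"
  assumes \<tau>: "\<And>i. i < n \<Longrightarrow> \<tau> i \<le> \<tau> (Suc i)"
    and D: "\<And>i. i < n \<Longrightarrow> D i tagged_division_of {\<tau> i..\<tau> (Suc i)}"
    and F: "F {} = 0" "\<And>u. F {u} = 0"
  obtains \<D> where "\<D> division_of {\<tau> 0..\<tau> n}" "(\<Sum>i<n. \<Sum>(t,K)\<in>D i. F K) = (\<Sum>K\<in>\<D>. F K)"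
proof -
  have F0: "F K = 0" if "interior K = {}" "K = cbox u v" for K u v
  proof -
    have "v \<le> u" using that by (auto simp: interior_cbox)
    thus ?thesis using that F by (cases "u = v") auto
  qed
  have "\<tau> 0 \<le> \<tau> n \<and> (\<exists>\<D>. \<D> division_of {\<tau> 0..\<tau> n} \<and> (\<Sum>i<n. \<Sum>(t,K)\<in>D i. F K) = (\<Sum>K\<in>\<D>. F K))"
    using \<tau> D
  proof (induction n)
    case 0
    have "{{\<tau> 0}} division_of {\<tau> 0}" using division_of_self[of "\<tau> 0" "\<tau> 0"] by simp
    then show ?case using F(2) by (intro conjI exI[of _ "{{\<tau> 0}}"]) auto
  next
    case (Suc n)
    then obtain \<D> where le: "\<tau> 0 \<le> \<tau> n" and \<D>: "\<D> division_of {\<tau> 0..\<tau> n}"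
      "(\<Sum>i<n. \<Sum>(t,K)\<in>D i. F K) = (\<Sum>K\<in>\<D>. F K)" by auto
    have \<tau>n: "\<tau> n \<le> \<tau> (Suc n)" and Dn: "D n tagged_division_of {\<tau> n..\<tau> (Suc n)}" using Suc.prems by auto
    let ?E = "snd ` D n"
    have E: "?E division_of {\<tau> n..\<tau> (Suc n)}" by (rule division_of_tagged_division[OF Dn])
    have un: "{\<tau> 0..\<tau> n} \<union> {\<tau> n..\<tau> (Suc n)} = {\<tau> 0..\<tau> (Suc n)}" using le \<tau>n by auto
    have "\<D> \<union> ?E division_of {\<tau> 0..\<tau> (Suc n)}"
      using division_disjoint_union[OF \<D>(1) E] un by (auto simp: disjoint_iff)
    moreover have "(\<Sum>K\<in>\<D> \<union> ?E. F K) = (\<Sum>K\<in>\<D>. F K) + (\<Sum>K\<in>?E. F K)"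
    proof (rule sum.union_inter_neutral)
      show "\<forall>K\<in>\<D> \<inter> ?E. F K = 0"
      proof
        fix K assume K: "K \<in> \<D> \<inter> ?E"
        then obtain u v where uv: "K = cbox u v" using division_ofD(4)[OF E] by blast
        \<comment> \<open>The two intervals meet only in the point \<open>\<tau> n\<close>, so a
          common member has empty interior.\<close>
        have "K \<subseteq> {\<tau> 0..\<tau> n} \<inter> {\<tau> n..\<tau> (Suc n)}"
          using division_ofD(2)[OF E] division_ofD(2)[OF \<D>(1)] K by blast
        hence "interior K \<subseteq> interior {\<tau> n}" using le by (intro interior_mono) auto
        thus "F K = 0" using F0[OF _ uv] by simp
      qed
    qed (use division_ofD(1)[OF \<D>(1)] division_ofD(1)[OF E] in auto)
    moreover have "(\<Sum>(t,K)\<in>D n. F K) = (\<Sum>K\<in>?E. F K)"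
      by (rule sum.over_tagged_division_lemma[OF Dn]) (use F0 in \<open>auto simp: interior_cbox\<close>)
    ultimately show ?case using le \<tau>n \<D>(2) by (intro conjI exI[of _ "\<D> \<union> ?E"]) auto
  qed
  thus thesis using that by blast
qed

text \<open>A bound for all divisions of the whole interval controls the pieces jointly, so that no
  factor \<open>n\<close> appears.\<close>

lemma variation_over_subdivision:
  fixes x :: "real \<Rightarrow> 'b::real_normed_vector"
  assumes \<tau>: "\<And>i. i < n \<Longrightarrow> \<tau> i \<le> \<tau> (Suc i)"
    and D: "\<And>i. i < n \<Longrightarrow> D i tagged_division_of {\<tau> i..\<tau> (Suc i)}"
    and V: "\<And>\<D>. \<D> division_of {\<tau> 0..\<tau> n} \<Longrightarrow> (\<Sum>k\<in>\<D>. norm (x (Sup k) - x (Inf k))) \<le> V"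
  shows "(\<Sum>i<n. \<Sum>(t,K)\<in>D i. norm (x (Sup K) - x (Inf K))) \<le> V"
proof -
  \<comment> \<open>The value at the empty set is set to 0 because \<open>Sup {}\<close> and
    \<open>Inf {}\<close> of reals carry no information; members of the divisions are nonempty, so
    no sum changes.\<close>
  define F where "F K = (if K = {} then 0 else norm (x (Sup K) - x (Inf K)))" for K
  obtain \<D> where \<D>: "\<D> division_of {\<tau> 0..\<tau> n}" "(\<Sum>i<n. \<Sum>(t,K)\<in>D i. F K) = (\<Sum>K\<in>\<D>. F K)"
    by (rule sum_over_subdivision[of n \<tau> D F]) (use D \<tau> in \<open>auto simp: F_def\<close>)
  have "(\<Sum>i<n. \<Sum>(t,K)\<in>D i. norm (x (Sup K) - x (Inf K))) = (\<Sum>i<n. \<Sum>(t,K)\<in>D i. F K)"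
  proof (rule sum.cong[OF refl])
    fix i assume "i \<in> {..<n}"
    hence "\<And>t K. (t, K) \<in> D i \<Longrightarrow> K \<noteq> {}" using tagged_division_ofD(2)[OF D] by fastforce
    thus "(\<Sum>(t,K)\<in>D i. norm (x (Sup K) - x (Inf K))) = (\<Sum>(t,K)\<in>D i. F K)"
      unfolding F_def by (intro sum.cong) auto
  qed
  also have "\<dots> = (\<Sum>K\<in>\<D>. norm (x (Sup K) - x (Inf K)))"
    unfolding \<D>(2) using division_ofD(3)[OF \<D>(1)] by (intro sum.cong) (auto simp: F_def)
  also have "\<dots> \<le> V" by (rule V[OF \<D>(1)])
  finally show ?thesis .
qed

section \<open>Riemann-Stieltjes sums\<close>

text \<open>The term \<open>w \<bullet> (x b - x a)\<close> telescopes over a tagged division and is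
  compared summand by summand; a Lebesgue number makes the local hypothesis uniform. The integrated
  coordinates \<open>h\<close> and the coordinates \<open>x\<close> that measure the error may
  belong to different charts; for a Legendrian curve \<open>w = 0\<close> and
  \<open>h = x\<close>.\<close>

lemma RS_sums_close:
  fixes f h x :: "real \<Rightarrow> 'b::real_inner"
  assumes "a \<le> b"
    and loc: "\<And>s. s \<in> {a..b} \<Longrightarrow> \<exists>\<delta>>0. \<forall>t\<in>{a..b} \<inter> ball s \<delta>. \<forall>u\<in>{a..b} \<inter> ball s \<delta>. \<forall>v\<in>{a..b} \<inter> ball s \<delta>.
      \<bar>f t \<bullet> (h v - h u) - w \<bullet> (x v - x u)\<bar> \<le> \<eta> * norm (x v - x u)"
  obtains \<delta> where "\<delta> > 0"
    "\<And>\<D>. \<D> tagged_division_of {a..b} \<Longrightarrow> (\<lambda>t. ball t \<delta>) fine \<D> \<Longrightarrow>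
       \<bar>(\<Sum>(t,K)\<in>\<D>. f t \<bullet> (h (Sup K) - h (Inf K))) - w \<bullet> (x b - x a)\<bar>
       \<le> \<eta> * (\<Sum>(t,K)\<in>\<D>. norm (x (Sup K) - x (Inf K)))"
proof -
  obtain e where e: "\<And>s. s \<in> {a..b} \<Longrightarrow> e s > 0"
    "\<And>s t u v. s \<in> {a..b} \<Longrightarrow> t \<in> {a..b} \<inter> ball s (e s) \<Longrightarrow> u \<in> {a..b} \<inter> ball s (e s) \<Longrightarrow> v \<in> {a..b} \<inter> ball s (e s) \<Longrightarrow>
      \<bar>f t \<bullet> (h v - h u) - w \<bullet> (x v - x u)\<bar> \<le> \<eta> * norm (x v - x u)"
    using loc by metis
  obtain \<delta> where \<delta>: "\<delta> > 0" "\<And>t. t \<in> {a..b} \<Longrightarrow> \<exists>s\<in>{a..b}. ball t \<delta> \<subseteq> ball s (e s)"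
  proof (rule Heine_Borel_lemma[of "{a..b}" "(\<lambda>s. ball s (e s)) ` {a..b}"])
    show "{a..b} \<subseteq> \<Union> ((\<lambda>s. ball s (e s)) ` {a..b})" using e(1) by force
  qed (auto intro: that)
  show thesis
  proof (rule that[OF \<delta>(1)])
    fix \<D> assume D: "\<D> tagged_division_of {a..b}" and fine: "(\<lambda>t. ball t \<delta>) fine \<D>"
    have "(\<Sum>(t,K)\<in>\<D>. f t \<bullet> (h (Sup K) - h (Inf K))) - w \<bullet> (x b - x a) =
      (\<Sum>(t,K)\<in>\<D>. f t \<bullet> (h (Sup K) - h (Inf K)) - w \<bullet> (x (Sup K) - x (Inf K)))"
      unfolding additive_tagged_division_1[OF assms(1) D, symmetric]
      by (simp add: inner_sum_right split_def flip: sum_subtractf)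
    also have "\<bar>\<dots>\<bar> \<le> (\<Sum>(t,K)\<in>\<D>. \<bar>f t \<bullet> (h (Sup K) - h (Inf K)) - w \<bullet> (x (Sup K) - x (Inf K))\<bar>)"
      using sum_abs by (metis (mono_tags, lifting) split_def sum.cong)
    also have "\<dots> \<le> (\<Sum>(t,K)\<in>\<D>. \<eta> * norm (x (Sup K) - x (Inf K)))"
    proof (rule sum_mono, clarify)
      fix t K assume tK: "(t, K) \<in> \<D>"
      obtain u v where uv: "K = {u..v}" "t \<in> {u..v}" "{u..v} \<subseteq> {a..b}"
        using tagged_division_ofD(2,3,4)[OF D tK] by (metis box_real(2))
      have sub: "{u..v} \<subseteq> ball t \<delta>" using fineD[OF fine tK] uv by simp
      obtain s where s: "s \<in> {a..b}" "ball t \<delta> \<subseteq> ball s (e s)" using \<delta>(2)[of t] uv by blast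
      have "{t,u,v} \<subseteq> {u..v}" using uv by auto
      hence "{t,u,v} \<subseteq> {a..b} \<inter> ball s (e s)" using sub s uv by blast
      hence "\<bar>f t \<bullet> (h v - h u) - w \<bullet> (x v - x u)\<bar> \<le> \<eta> * norm (x v - x u)"
        by (intro e(2)[OF s(1)]) auto
      thus "\<bar>f t \<bullet> (h (Sup K) - h (Inf K)) - w \<bullet> (x (Sup K) - x (Inf K))\<bar> \<le> \<eta> * norm (x (Sup K) - x (Inf K))"
        using uv by auto
    qed
    also have "\<dots> = \<eta> * (\<Sum>(t,K)\<in>\<D>. norm (x (Sup K) - x (Inf K)))"
      by (simp add: sum_distrib_left split_def)
    finally show "\<bar>(\<Sum>(t,K)\<in>\<D>. f t \<bullet> (h (Sup K) - h (Inf K))) - w \<bullet> (x b - x a)\<bar>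
       \<le> \<eta> * (\<Sum>(t,K)\<in>\<D>. norm (x (Sup K) - x (Inf K)))" .
  qed
qed

section \<open>Angles to a plane\<close>

text \<open>Zero vectors are covered too: division by 0 gives 0, which lies in the domain of
  \<open>arccos\<close>.\<close>

lemma vector_angle_bounds:
  "0 \<le> vector_angle u v" "-1 \<le> u \<bullet> v / (norm u * norm v)" "u \<bullet> v / (norm u * norm v) \<le> 1"
proof -
  have "\<bar>u \<bullet> v / (norm u * norm v)\<bar> \<le> 1"
    using Cauchy_Schwarz_ineq2[of u v] by (simp add: divide_le_eq)
  thus a: "-1 \<le> u \<bullet> v / (norm u * norm v)" "u \<bullet> v / (norm u * norm v) \<le> 1" by linarith+
  show "0 \<le> vector_angle u v" unfolding vector_angle_def by (rule arccos_lbound[OF a])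
qed

text \<open>An infimum of reals below \<epsilon> yields a vector with angle below \<epsilon> if the
  set is nonempty and bounded below; this lemma and the next supply the two conditions.\<close>

lemma bdd_below_vector_angle: "bdd_below (vector_angle u ` S)"
  by (rule bdd_belowI2) (rule vector_angle_bounds(1))

lemma orthogonal_complement_nontrivial:
  fixes b :: "real^3"
  shows "{v. b \<bullet> v = 0} - {0} \<noteq> {}"
proof -
  obtain y where "y \<noteq> 0" "orthogonal b y"
    using orthogonal_to_vector_exists[of b] by auto
  thus ?thesis by (auto simp: orthogonal_def)
qed

text \<open>For the normal vector \<open>b\<close>, the quotient of
  \<open>\<bar>b \<bullet> u\<bar>\<close> by \<open>norm b * norm u\<close> is the sine of the
  angle to the plane, and a sine is at most its angle.\<close>

lemma inner_le_of_angle_less: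
  fixes b u :: "real^3"
  assumes "b \<noteq> 0" "u \<noteq> 0" "0 < \<epsilon>" "angle_to_plane u {v. b \<bullet> v = 0} < \<epsilon>"
  shows "\<bar>b \<bullet> u\<bar> \<le> \<epsilon> * (norm b * norm u)"
proof (cases "\<epsilon> \<ge> 1")
  case True
  have "\<bar>b \<bullet> u\<bar> \<le> 1 * (norm b * norm u)" using Cauchy_Schwarz_ineq2[of b u] by simp
  also have "\<dots> \<le> \<epsilon> * (norm b * norm u)" using True by (intro mult_right_mono) auto
  finally show ?thesis .
next
  case False
  obtain v where v: "b \<bullet> v = 0" "v \<noteq> 0" "vector_angle u v < \<epsilon>"
    using assms(4) cINF_less_iff[OF orthogonal_complement_nontrivial bdd_below_vector_angle, of u b \<epsilon>]
    unfolding angle_to_plane_def by blast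
  let ?c = "u \<bullet> v / (norm u * norm v)"
  \<comment> \<open>An angle below 1 is less than pi / 2, so its cosine is positive and the
    inequality between cosines may be squared.\<close>
  have eps: "\<epsilon> < pi / 2" using False pi_half_gt_zero pi_gt3 by linarith
  have "cos \<epsilon> < ?c"
  proof -
    have "cos \<epsilon> < cos (arccos ?c)"
      using v(3) vector_angle_bounds[of u v] eps unfolding vector_angle_def by (intro cos_monotone_0_pi) auto
    thus ?thesis using vector_angle_bounds(2,3) by (simp add: cos_arccos)
  qed
  hence c: "(cos \<epsilon>)\<^sup>2 \<le> ?c\<^sup>2" using cos_gt_zero[of \<epsilon>] eps assms(3) by (intro power_mono) auto
  text \<open>Bessel's inequality for the orthogonal pair \<open>b, v\<close>.\<close>
  define p q where "p = b \<bullet> u / (b \<bullet> b)" and "q = u \<bullet> v / (v \<bullet> v)"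
  have pq: "p * (b \<bullet> b) = b \<bullet> u" "q * (v \<bullet> v) = u \<bullet> v"
    using assms(1) v(2) unfolding p_def q_def by simp_all
  have "0 \<le> (u - p *\<^sub>R b - q *\<^sub>R v) \<bullet> (u - p *\<^sub>R b - q *\<^sub>R v)" by simp
  also have "\<dots> = u \<bullet> u - 2 * p * (b \<bullet> u) - 2 * q * (u \<bullet> v) + p * (p * (b \<bullet> b)) + q * (q * (v \<bullet> v))"
    using v(1) by (simp add: inner_diff_left inner_diff_right inner_commute algebra_simps)
  also have "\<dots> = u \<bullet> u - (b \<bullet> u)\<^sup>2 / (b \<bullet> b) - (u \<bullet> v)\<^sup>2 / (v \<bullet> v)"
    unfolding pq by (simp add: p_def q_def power2_eq_square)
  finally have "(b \<bullet> u)\<^sup>2 / (norm b)\<^sup>2 + ?c\<^sup>2 * (norm u)\<^sup>2 \<le> (norm u)\<^sup>2"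
    using assms(2) by (simp add: power_divide power_mult_distrib dot_square_norm)
  moreover have "(cos \<epsilon>)\<^sup>2 * (norm u)\<^sup>2 \<le> ?c\<^sup>2 * (norm u)\<^sup>2" using c by (intro mult_right_mono) auto
  ultimately have "(b \<bullet> u)\<^sup>2 / (norm b)\<^sup>2 \<le> (1 - (cos \<epsilon>)\<^sup>2) * (norm u)\<^sup>2" by (simp add: algebra_simps)
  also have "\<dots> = (sin \<epsilon>)\<^sup>2 * (norm u)\<^sup>2" by (simp add: sin_squared_eq)
  also have "\<dots> \<le> \<epsilon>\<^sup>2 * (norm u)\<^sup>2"
    using sin_x_le_x[of \<epsilon>] sin_gt_zero[of \<epsilon>] assms(3) eps by (intro mult_right_mono power_mono) auto
  finally have "(b \<bullet> u)\<^sup>2 \<le> (\<epsilon> * (norm b * norm u))\<^sup>2"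
    using assms(1) by (simp add: divide_le_eq power_mult_distrib mult_ac)
  thus ?thesis using assms(3) by (simp add: abs_le_square_iff[symmetric])
qed

text \<open>The witness is the orthogonal projection \<open>v\<close> of \<open>u\<close> to the
  plane; the cosine of its angle with \<open>u\<close> is \<open>norm v / norm u\<close>. The half
  angle leaves room for the strict inequality.\<close>

lemma angle_less_of_inner_le:
  fixes b u :: "real^3"
  assumes "b \<noteq> 0" "u \<noteq> 0" "0 < \<epsilon>" "\<epsilon> \<le> 1" "\<bar>b \<bullet> u\<bar> \<le> sin (\<epsilon> / 2) * (norm b * norm u)"
  shows "angle_to_plane u {v. b \<bullet> v = 0} < \<epsilon>"
proof -
  define v where "v = u - (b \<bullet> u / (b \<bullet> b)) *\<^sub>R b"
  have eps: "\<epsilon> / 2 < pi / 2" using assms(4) pi_gt3 by linarith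
  have cos: "cos (\<epsilon> / 2) > 0" using cos_gt_zero[of "\<epsilon> / 2"] eps assms(3) by auto
  have bv: "b \<bullet> v = 0" using assms(1) unfolding v_def by (simp add: inner_diff_right)
  have vv: "v \<bullet> v = u \<bullet> u - (b \<bullet> u)\<^sup>2 / (b \<bullet> b)"
    using assms(1) unfolding v_def
    by (simp add: inner_diff_left inner_diff_right inner_commute field_simps power2_eq_square)
  have uv: "u \<bullet> v = v \<bullet> v"
    using bv unfolding v_def by (simp add: inner_diff_left)
  have "(b \<bullet> u)\<^sup>2 \<le> (sin (\<epsilon> / 2) * (norm b * norm u))\<^sup>2"
    using assms(5) by (metis abs_le_square_iff abs_of_nonneg abs_ge_zero order_trans)
  hence "(b \<bullet> u)\<^sup>2 / (b \<bullet> b) \<le> (sin (\<epsilon> / 2))\<^sup>2 * (u \<bullet> u)"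
    using assms(1) by (simp add: divide_le_eq power_mult_distrib mult_ac dot_square_norm)
  hence "(cos (\<epsilon> / 2))\<^sup>2 * (u \<bullet> u) \<le> v \<bullet> v"
    unfolding vv by (simp add: cos_squared_eq algebra_simps)
  hence "(cos (\<epsilon> / 2) * norm u)\<^sup>2 \<le> (norm v)\<^sup>2" by (simp add: power_mult_distrib dot_square_norm)
  hence le: "cos (\<epsilon> / 2) * norm u \<le> norm v" using power2_le_imp_le by fastforce
  moreover have "0 < cos (\<epsilon> / 2) * norm u" using cos assms(2) by simp
  ultimately have v0: "v \<noteq> 0" by force
  have "u \<bullet> v / (norm u * norm v) = norm v / norm u"
    using v0 assms(2) unfolding uv by (simp add: dot_square_norm power2_eq_square)
  hence c: "cos (\<epsilon> / 2) \<le> u \<bullet> v / (norm u * norm v)"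
    using le assms(2) by (simp add: le_divide_eq)
  have "vector_angle u v \<le> arccos (cos (\<epsilon> / 2))"
    unfolding vector_angle_def using c cos vector_angle_bounds(3) by (intro arccos_le_arccos) auto
  also have "\<dots> = \<epsilon> / 2" using assms(3) eps by (intro arccos_cos) auto
  also have "\<dots> < \<epsilon>" using assms(3) by simp
  finally show ?thesis
    using bv v0 cINF_less_iff[OF orthogonal_complement_nontrivial bdd_below_vector_angle, of u b \<epsilon>]
    unfolding angle_to_plane_def by blast
qed

section \<open>The contact form in coordinates\<close>

lemma continuous_on_delta:
  fixes h :: "'a::metric_space \<Rightarrow> 'b::topological_space"
  assumes "continuous_on S h" "open U" "s \<in> S" "h s \<in> U"
  obtains \<delta> where "\<delta> > 0" "\<And>t. t \<in> S \<Longrightarrow> dist t s < \<delta> \<Longrightarrow> h t \<in> U"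
proof -
  have "(h \<longlongrightarrow> h s) (at s within S)" using assms(1,3) unfolding continuous_on_def by blast
  hence "\<forall>\<^sub>F t in at s within S. h t \<in> U" using assms(2,4) by (rule topological_tendstoD)
  then obtain \<delta> where "\<delta> > 0" "\<And>t. t \<in> S \<Longrightarrow> t \<noteq> s \<Longrightarrow> dist t s < \<delta> \<Longrightarrow> h t \<in> U"
    unfolding eventually_at by blast
  thus thesis using that assms(4) by metis
qed

lemma one_form_eq_inner:
  assumes "smooth_one_form_on A W \<alpha>" "c \<in> A" "is_chart c" "p \<in> W" "p \<in> chart_dom c"
  shows "\<alpha> p (tangent_vec c p v) = form_coeffs \<alpha> c (crd c p) \<bullet> v"
proof -
  have lin: "linear (\<lambda>v. \<alpha> p (tangent_vec c p v))"
    using assms unfolding smooth_one_form_on_def by blast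
  have "\<alpha> p (tangent_vec c p v) = \<alpha> p (tangent_vec c p (\<Sum>i\<in>UNIV. v $ i *\<^sub>R axis i 1))"
    using basis_expansion[of v] by (simp add: scalar_mult_eq_scaleR)
  also have "\<dots> = (\<Sum>i\<in>UNIV. v $ i * \<alpha> p (tangent_vec c p (axis i 1)))"
    using linear_sum[OF lin, of "\<lambda>i. v $ i *\<^sub>R axis i 1" UNIV] linear_cmul[OF lin] by simp
  also have "\<dots> = form_coeffs \<alpha> c (crd c p) \<bullet> v"
    unfolding form_coeffs_def using chartD(6)[OF assms(3,5)] by (simp add: inner_vec_def mult.commute)
  finally show ?thesis .
qed

text \<open>Transformation law of a covector: both sides are the value of \<alpha> on one and the
  same tangent vector.\<close>

lemma form_coeffs_change:
  assumes "smooth_one_form_on A W \<alpha>" "smooth_atlas A" "c \<in> A" "c' \<in> A"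
    "p \<in> W" "p \<in> chart_dom c" "p \<in> chart_dom c'"
  shows "form_coeffs \<alpha> c' (crd c' p) \<bullet> dtrans c c' p v = form_coeffs \<alpha> c (crd c p) \<bullet> v"
proof -
  interpret chart_pair c c' by (rule smooth_atlas_chart_pair[OF assms(2-4)])
  show ?thesis
    using one_form_eq_inner[OF assms(1,3) chart assms(5,6), of v] tangent_vec_change[OF assms(6,7), of v]
      one_form_eq_inner[OF assms(1,4) chart' assms(5,7), of "dtrans c c' p v"] by simp
qed

lemma form_coeffs_near:
  assumes "smooth_one_form_on A W \<alpha>" "c \<in> A" "is_chart c" "open W" "p \<in> W" "p \<in> chart_dom c" "\<eta> > 0"
  obtains U where "open U" "p \<in> U" "U \<subseteq> W \<inter> chart_dom c"
    "\<And>q. q \<in> U \<Longrightarrow> norm (form_coeffs \<alpha> c (crd c q) - form_coeffs \<alpha> c (crd c p)) < \<eta>"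
proof -
  let ?S = "crd c ` (W \<inter> chart_dom c)" and ?a = "form_coeffs \<alpha> c"
  have "smooth_on ?a ?S" using assms(1,2) unfolding smooth_one_form_on_def by blast
  hence "Ck_on 0 ?a ?S" unfolding smooth_on_def by blast
  hence cont: "continuous_on ?S ?a" by simp
  have opS: "open (?S \<inter> ?a -` ball (?a (crd c p)) \<eta>)"
    by (rule continuous_open_preimage[OF cont open_chart_image[OF assms(3,4)] open_ball])
  let ?U = "W \<inter> (chart_dom c \<inter> crd c -` (?S \<inter> ?a -` ball (?a (crd c p)) \<eta>))"
  show thesis
  proof (rule that)
    show "open ?U" using open_chart_preimage[OF assms(3) opS] assms(4) by blast
  qed (use assms in \<open>auto simp: dist_norm norm_minus_commute\<close>)
qed

lemma tangent_space_eq_range: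
  assumes "smooth_atlas A" "c \<in> A" "p \<in> chart_dom c"
  shows "tangent_space A p = range (tangent_vec c p)"
proof
  show "tangent_space A p \<subseteq> range (tangent_vec c p)"
  proof
    fix X assume "X \<in> tangent_space A p"
    then obtain c' v where X: "X = tangent_vec c' p v" "c' \<in> A" "p \<in> chart_dom c'"
      unfolding tangent_space_def by blast
    thus "X \<in> range (tangent_vec c p)"
      using chart_pair.tangent_vec_change[OF smooth_atlas_chart_pair[OF assms(1) X(2) assms(2)] X(3) assms(3)]
      by blast
  qed
  show "range (tangent_vec c p) \<subseteq> tangent_space A p"
    unfolding tangent_space_def using assms by blast
qed

text \<open>The coordinates \<open>c\<close> may lie outside the atlas, where the hypotheses on
  \<alpha> say nothing about its coefficients. The normal vector \<open>b\<close> is therefore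
  pulled back from the atlas chart \<open>c0\<close> by the derivative of the transition map from
  \<open>c\<close> to \<open>c0\<close>, and the last equation keeps it tied to
  \<open>c0\<close>.\<close>

lemma components_contact_plane:
  assumes A: "smooth_atlas A" and \<xi>: "contact_structure A \<xi>" and \<alpha>: "contact_form_on A \<xi> W \<alpha>"
    and c0: "c0 \<in> A" and c: "C1_coordinates A c" and p: "p \<in> W" "p \<in> chart_dom c0" "p \<in> chart_dom c"
  obtains b where "b \<noteq> 0" "components c ` \<xi> p = {v. b \<bullet> v = 0}"
    "\<And>v. b \<bullet> dtrans c0 c p v = form_coeffs \<alpha> c0 (crd c0 p) \<bullet> v"
proof -
  interpret chart_pair c0 c
    using A c0 c unfolding C1_coordinates_def smooth_atlas_def
    by (intro chart_pair.intro) (auto intro: Ck_compatible_sym)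
  interpret s: chart_pair c c0 by (rule swap)
  define a where "a = form_coeffs \<alpha> c0 (crd c0 p)"
  have form: "smooth_one_form_on A W \<alpha>" and ker: "\<xi> p = form_kernel A \<alpha> p"
    using \<alpha> p(1) unfolding contact_form_on_def by auto
  have \<xi>p: "\<xi> p = tangent_vec c0 p ` {v. a \<bullet> v = 0}"
    unfolding ker form_kernel_def tangent_space_eq_range[OF A c0 p(2)] a_def
    using one_form_eq_inner[OF form c0 chart p(1,2)] by auto
  \<comment> \<open>A form vanishing at \<open>p\<close> would have the whole tangent space as
    kernel there, against \<open>dim P = 2\<close>.\<close>
  have "a \<noteq> 0"
  proof
    assume a: "a = 0"
    obtain P where P: "dim P = 2" "\<xi> p = tangent_vec c0 p ` P"
      using \<xi> c0 p(2) unfolding contact_structure_def plane_field_def by blast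
    have id: "components c0 ` tangent_vec c0 p ` S = S" for S
      by (simp add: image_image components_tangent_vec_same[OF chart p(2)])
    have "P = components c0 ` \<xi> p" unfolding P(2) id ..
    also have "\<dots> = {v. a \<bullet> v = 0}" unfolding \<xi>p id ..
    also have "\<dots> = UNIV" unfolding a by simp
    finally have "P = UNIV" .
    thus False using P(1) by simp
  qed
  define b where "b = (\<chi> i. a \<bullet> dtrans c c0 p (axis i 1))"
  have b: "b \<bullet> w = a \<bullet> dtrans c c0 p w" for w
  proof -
    have lin: "linear (\<lambda>w. a \<bullet> dtrans c c0 p w)"
      using s.linear_dtrans[OF p(3,2)] by (intro linearI) (simp_all add: linear_add linear_cmul inner_add_right)
    have "a \<bullet> dtrans c c0 p w = a \<bullet> dtrans c c0 p (\<Sum>i\<in>UNIV. w $ i *\<^sub>R axis i 1)"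
      using basis_expansion[of w] by (simp add: scalar_mult_eq_scaleR)
    also have "\<dots> = (\<Sum>i\<in>UNIV. w $ i * (a \<bullet> dtrans c c0 p (axis i 1)))"
      using linear_sum[OF lin, of "\<lambda>i. w $ i *\<^sub>R axis i 1" UNIV] linear_cmul[OF lin] by simp
    also have "\<dots> = b \<bullet> w" unfolding b_def by (simp add: inner_vec_def mult.commute)
    finally show ?thesis ..
  qed
  have inv: "dtrans c c0 p (dtrans c0 c p v) = v" "dtrans c0 c p (dtrans c c0 p v) = v" for v
    using dtrans_inverse[OF p(2,3)] s.dtrans_inverse[OF p(3,2)] by auto
  show thesis
  proof (rule that)
    show "b \<bullet> dtrans c0 c p v = form_coeffs \<alpha> c0 (crd c0 p) \<bullet> v" for v
      using b inv(1) a_def by simp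
    show "b \<noteq> 0" using b[of "dtrans c0 c p a"] inv(1)[of a] \<open>a \<noteq> 0\<close> by auto
    have "components c ` \<xi> p = dtrans c0 c p ` {v. a \<bullet> v = 0}"
      unfolding \<xi>p image_image components_tangent_vec[OF p(2,3)] ..
    also have "\<dots> = {v. b \<bullet> v = 0}"
    proof
      show "dtrans c0 c p ` {v. a \<bullet> v = 0} \<subseteq> {v. b \<bullet> v = 0}" using b inv(1) by auto
      show "{v. b \<bullet> v = 0} \<subseteq> dtrans c0 c p ` {v. a \<bullet> v = 0}"
      proof
        fix v assume "v \<in> {v. b \<bullet> v = 0}"
        hence "a \<bullet> dtrans c c0 p v = 0" using b by simp
        thus "v \<in> dtrans c0 c p ` {v. a \<bullet> v = 0}"
          using inv(2) by (intro image_eqI[of _ _ "dtrans c c0 p v"]) simp_all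
      qed
    qed
    finally show "components c ` \<xi> p = {v. b \<bullet> v = 0}" .
  qed
qed

section \<open>Values of the form on coordinate increments\<close>

lemma dtrans_same:
  assumes "is_chart c" "p \<in> chart_dom c"
  shows "dtrans c c p v = v"
  using chart_pair.components_tangent_vec[of c c p v, OF chart_pair.intro[OF assms(1,1) Ck_compatible_refl_1[OF assms(1)]] assms(2,2)]
    components_tangent_vec_same[OF assms] by simp

text \<open>The Legendrian condition refers to the plane at \<open>p\<close>, a Riemann-Stieltjes
  sum to the coefficients at its tags; hence the separate point \<open>q\<close>. Half of \<eta>
  pays for the angle, half for moving the coefficients from \<open>p\<close> to
  \<open>q\<close>.\<close>

lemma legendrian_imp_form_small:
  assumes A: "smooth_atlas A" and \<xi>: "contact_structure A \<xi>" and \<alpha>: "contact_form_on A \<xi> W \<alpha>" and W: "open W"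
    and L: "legendrian A \<xi> L" and p: "p \<in> L" "p \<in> W" and c: "c \<in> A" "p \<in> chart_dom c" and \<eta>: "\<eta> > 0"
  obtains U where "open U" "p \<in> U" "U \<subseteq> W \<inter> chart_dom c"
    "\<And>q q' q''. q \<in> U \<Longrightarrow> q' \<in> L \<inter> U \<Longrightarrow> q'' \<in> L \<inter> U \<Longrightarrow>
       \<bar>form_coeffs \<alpha> c (crd c q) \<bullet> (crd c q'' - crd c q')\<bar> \<le> \<eta> * norm (crd c q'' - crd c q')"
proof -
  have C1: "C1_coordinates A c" and chart: "is_chart c"
    using smooth_atlas_C1_coordinates[OF A c(1)] unfolding C1_coordinates_def by auto
  let ?a = "form_coeffs \<alpha> c"
  obtain b where b: "b \<noteq> 0" "components c ` \<xi> p = {v. b \<bullet> v = 0}"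
    "\<And>v. b \<bullet> dtrans c c p v = ?a (crd c p) \<bullet> v"
    using components_contact_plane[OF A \<xi> \<alpha> c(1) C1 p(2) c(2,2)] by blast
  have ba: "b \<bullet> v = ?a (crd c p) \<bullet> v" for v using b(3) dtrans_same[OF chart c(2)] by simp
  define \<epsilon> where "\<epsilon> = \<eta> / (2 * norm b)"
  have \<epsilon>: "\<epsilon> > 0" "\<epsilon> * norm b = \<eta> / 2" using b(1) \<eta> unfolding \<epsilon>_def by auto
  obtain U1 where U1: "open U1" "p \<in> U1" "U1 \<subseteq> chart_dom c"
    "\<And>q' q''. q' \<in> L \<inter> U1 \<Longrightarrow> q'' \<in> L \<inter> U1 \<Longrightarrow> q' \<noteq> q'' \<Longrightarrow>
      angle_to_plane (crd c q'' - crd c q') (components c ` \<xi> p) < \<epsilon>"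
    using L p(1) C1 c(2) \<epsilon>(1) unfolding legendrian_def by meson
  obtain U2 where U2: "open U2" "p \<in> U2" "U2 \<subseteq> W \<inter> chart_dom c"
    "\<And>q. q \<in> U2 \<Longrightarrow> norm (?a (crd c q) - ?a (crd c p)) < \<eta> / 2"
    using form_coeffs_near[of A W \<alpha> c p "\<eta> / 2"] \<alpha> c chart W p(2) \<eta>
    unfolding contact_form_on_def by (metis half_gt_zero)
  show thesis
  proof (rule that[of "U1 \<inter> U2"])
    fix q q' q'' assume q: "q \<in> U1 \<inter> U2" "q' \<in> L \<inter> (U1 \<inter> U2)" "q'' \<in> L \<inter> (U1 \<inter> U2)"
    let ?v = "crd c q'' - crd c q'"
    have "\<bar>?a (crd c p) \<bullet> ?v\<bar> \<le> \<eta> / 2 * norm ?v"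
    proof (cases "q' = q''")
      case False
      have "?v \<noteq> 0" using inj_onD[OF chartD(5)[OF chart], of q'' q'] False q U1(3) by auto
      moreover have "angle_to_plane ?v {v. b \<bullet> v = 0} < \<epsilon>"
        using U1(4)[of q' q''] False q b(2) by auto
      ultimately have "\<bar>b \<bullet> ?v\<bar> \<le> \<epsilon> * (norm b * norm ?v)"
        using inner_le_of_angle_less[OF b(1) _ \<epsilon>(1)] by blast
      also have "\<dots> = \<eta> / 2 * norm ?v" using \<epsilon>(2) by (simp flip: mult.assoc)
      finally show ?thesis unfolding ba .
    qed simp
    moreover have "\<bar>(?a (crd c q) - ?a (crd c p)) \<bullet> ?v\<bar> \<le> \<eta> / 2 * norm ?v"
      using U2(4)[of q] q by (intro order_trans[OF Cauchy_Schwarz_ineq2] mult_right_mono) auto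
    ultimately show "\<bar>?a (crd c q) \<bullet> ?v\<bar> \<le> \<eta> * norm ?v"
      unfolding inner_diff_left by linarith
  qed (use U1 U2 in auto)
qed

text \<open>This compares the sums in an arbitrary chart \<open>c'\<close> of a subdivision with
  increments in one fixed chart \<open>c\<close>. Both expressions agree to first order at
  \<open>q\<close>, by the law for covectors and strict differentiability of the transition
  map.\<close>

lemma form_increment_change:
  assumes A: "smooth_atlas A" and \<alpha>: "smooth_one_form_on A W \<alpha>" and W: "open W"
    and c: "c \<in> A" "c' \<in> A" and q: "q \<in> W" "q \<in> chart_dom c" "q \<in> chart_dom c'" and \<eta>: "\<eta> > 0"
  obtains U where "open U" "q \<in> U"
    "\<And>z q' q''. z \<in> U \<Longrightarrow> q' \<in> U \<Longrightarrow> q'' \<in> U \<Longrightarrow>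
       \<bar>form_coeffs \<alpha> c' (crd c' z) \<bullet> (crd c' q'' - crd c' q') - form_coeffs \<alpha> c (crd c q) \<bullet> (crd c q'' - crd c q')\<bar>
       \<le> \<eta> * norm (crd c q'' - crd c q')"
proof -
  interpret chart_pair c c' by (rule smooth_atlas_chart_pair[OF A c])
  let ?a' = "form_coeffs \<alpha> c'" and ?T = "dtrans c c' q"
  obtain B where B: "B > 0" "\<And>v. norm (?T v) \<le> B * norm v"
    using linear_bounded_pos[OF linear_dtrans[OF q(2,3)]] by blast
  have half: "y * (\<eta> / (2 * y)) = \<eta> / 2" if "y \<noteq> 0" for y using that by simp
  \<comment> \<open>\<eta>1 bounds the linearization error of the transition map. The 1 in the
    minimum gives \<open>norm ?y \<le> (B + 1) * norm ?x\<close> below; the added 1 keeps the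
    denominator positive.\<close>
  define \<eta>1 where "\<eta>1 = min 1 (\<eta> / (2 * (norm (?a' (crd c' q)) + 1)))"
  define \<eta>2 where "\<eta>2 = \<eta> / (2 * (B + 1))"
  have \<eta>1: "\<eta>1 > 0" "\<eta>1 \<le> 1" "norm (?a' (crd c' q)) * \<eta>1 \<le> \<eta> / 2"
  proof -
    show "\<eta>1 > 0" "\<eta>1 \<le> 1" using \<eta> unfolding \<eta>1_def by (auto simp: add_nonneg_pos)
    have "norm (?a' (crd c' q)) * \<eta>1 \<le> (norm (?a' (crd c' q)) + 1) * (\<eta> / (2 * (norm (?a' (crd c' q)) + 1)))"
      using \<eta> unfolding \<eta>1_def by (intro mult_mono) auto
    also have "\<dots> = \<eta> / 2" by (rule half) (use norm_ge_zero[of "?a' (crd c' q)"] in linarith)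
    finally show "norm (?a' (crd c' q)) * \<eta>1 \<le> \<eta> / 2" .
  qed
  have \<eta>2: "\<eta>2 > 0" "\<eta>2 * (B + 1) = \<eta> / 2"
    using \<eta> B(1) half[of "B + 1"] unfolding \<eta>2_def by (simp_all add: mult.commute)
  have crd_q: "crd c q \<in> crd c ` (chart_dom c \<inter> chart_dom c')" using q by blast
  obtain \<delta> where \<delta>: "\<delta> > 0" "ball (crd c q) \<delta> \<subseteq> crd c ` (chart_dom c \<inter> chart_dom c')"
    "\<And>x y. x \<in> ball (crd c q) \<delta> \<Longrightarrow> y \<in> ball (crd c q) \<delta> \<Longrightarrow>
       norm (transition c c' y - transition c c' x - ?T (y - x)) \<le> \<eta>1 * norm (y - x)"
    by (rule C1_strict_derivative[OF C1_trans open_overlap crd_q \<eta>1(1)]) (rule that)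
  obtain U2 where U2: "open U2" "q \<in> U2" "U2 \<subseteq> W \<inter> chart_dom c'"
    "\<And>z. z \<in> U2 \<Longrightarrow> norm (?a' (crd c' z) - ?a' (crd c' q)) < \<eta>2"
    by (rule form_coeffs_near[OF \<alpha> c(2) chart' W q(1,3) \<eta>2(1)]) (rule that)
  let ?U = "(chart_dom c \<inter> crd c -` ball (crd c q) \<delta>) \<inter> U2"
  show thesis
  proof (rule that[of ?U])
    show "open ?U" using open_chart_preimage[OF chart open_ball] U2(1) by blast
    show "q \<in> ?U" using q \<delta>(1) U2(2) by simp
    fix z q' q'' assume z: "z \<in> ?U" "q' \<in> ?U" "q'' \<in> ?U"
    let ?x = "crd c q'' - crd c q'" and ?y = "crd c' q'' - crd c' q'"
    have 1: "norm (?y - ?T ?x) \<le> \<eta>1 * norm ?x"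
      using \<delta>(3)[of "crd c q'" "crd c q''"] z trans_crd[of q'] trans_crd[of q''] by simp
    have "norm ?y \<le> norm (?y - ?T ?x) + norm (?T ?x)" using norm_triangle_ineq[of "?y - ?T ?x" "?T ?x"] by simp
    also have "\<dots> \<le> 1 * norm ?x + B * norm ?x"
      using 1 B(2)[of ?x] mult_right_mono[OF \<eta>1(2), of "norm ?x"] by simp
    finally have 2: "norm ?y \<le> (B + 1) * norm ?x" by (simp add: algebra_simps)
    have "\<bar>(?a' (crd c' z) - ?a' (crd c' q)) \<bullet> ?y\<bar> \<le> norm (?a' (crd c' z) - ?a' (crd c' q)) * norm ?y"
      by (rule Cauchy_Schwarz_ineq2)
    also have "\<dots> \<le> \<eta>2 * ((B + 1) * norm ?x)"
      using U2(4)[of z] z 2 \<eta>2(1) by (intro mult_mono) auto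
    also have "\<dots> = \<eta> / 2 * norm ?x" unfolding mult.assoc[symmetric] \<eta>2(2) ..
    finally have 3: "\<bar>(?a' (crd c' z) - ?a' (crd c' q)) \<bullet> ?y\<bar> \<le> \<eta> / 2 * norm ?x" .
    have "\<bar>?a' (crd c' q) \<bullet> (?y - ?T ?x)\<bar> \<le> norm (?a' (crd c' q)) * (\<eta>1 * norm ?x)"
      by (intro order_trans[OF Cauchy_Schwarz_ineq2] mult_left_mono 1) simp
    also have "\<dots> \<le> \<eta> / 2 * norm ?x"
      using mult_right_mono[OF \<eta>1(3), of "norm ?x"] by (simp add: mult.assoc)
    finally have 4: "\<bar>?a' (crd c' q) \<bullet> (?y - ?T ?x)\<bar> \<le> \<eta> / 2 * norm ?x" .
    have "?a' (crd c' z) \<bullet> ?y - form_coeffs \<alpha> c (crd c q) \<bullet> ?x =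
      (?a' (crd c' z) - ?a' (crd c' q)) \<bullet> ?y + ?a' (crd c' q) \<bullet> (?y - ?T ?x)"
      using form_coeffs_change[OF \<alpha> A c q, of ?x] by (simp add: inner_diff_left inner_diff_right)
    thus "\<bar>?a' (crd c' z) \<bullet> ?y - form_coeffs \<alpha> c (crd c q) \<bullet> ?x\<bar> \<le> \<eta> * norm ?x"
      using 3 4 by linarith
  qed
qed

section \<open>Legendrian curves and vanishing integrals\<close>

text \<open>Riemann-Stieltjes sums are replaced by increments with the constant coefficient vector
  \<open>w\<close>, which telescope across the pieces whatever their charts. The factor 2 consists
  of one \<eta> for the change of chart and one for freezing the coefficients.\<close>

lemma form_integral_zero_estimate:
  assumes A: "smooth_atlas A" and \<alpha>: "smooth_one_form_on A W \<alpha>" and W: "open W"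
    and c: "c \<in> A" and h: "arc h" "path_image h \<subseteq> W \<inter> chart_dom c"
    and int: "has_form_integral A \<alpha> h 0"
    and \<eta>: "\<eta> > 0" and w: "\<And>q. q \<in> path_image h \<Longrightarrow> norm (form_coeffs \<alpha> c (crd c q) - w) \<le> \<eta>"
    and V: "\<And>\<D>. \<D> division_of {0..1} \<Longrightarrow> (\<Sum>k\<in>\<D>. norm (crd c (h (Sup k)) - crd c (h (Inf k)))) \<le> V"
  shows "\<bar>w \<bullet> (crd c (pathfinish h) - crd c (pathstart h))\<bar> \<le> 2 * \<eta> * V"
proof -
  obtain n \<tau> cc J where sub: "chart_subdivision A h n \<tau> cc"
    and RS: "\<And>i. i < n \<Longrightarrow> has_RS_integral (\<lambda>t. form_coeffs \<alpha> (cc i) (crd (cc i) (h t))) (\<lambda>t. crd (cc i) (h t))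
        (\<tau> i) (\<tau> (Suc i)) (J i)"
    and J: "0 = (\<Sum>i<n. J i)"
    using int unfolding has_form_integral_def by blast
  have \<tau>: "\<tau> 0 = 0" "\<tau> n = 1" "\<And>i. i < n \<Longrightarrow> \<tau> i < \<tau> (Suc i)" "\<And>i. i < n \<Longrightarrow> cc i \<in> A"
    "\<And>i. i < n \<Longrightarrow> h ` {\<tau> i..\<tau> (Suc i)} \<subseteq> chart_dom (cc i)"
    using sub unfolding chart_subdivision_def by auto
  have mono: "\<tau> i \<le> \<tau> j" if "i \<le> j" "j \<le> n" for i j
    using that by (induction j) (auto simp: le_Suc_eq intro: order_trans[OF _ less_imp_le[OF \<tau>(3)]])
  have ss: "{\<tau> i..\<tau> (Suc i)} \<subseteq> {0..1}" if "i < n" for i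
    using \<tau>(1,2) mono[of 0 i] mono[of "Suc i" n] that by auto
  have conth: "continuous_on {0..1} h" using h(1) unfolding arc_def path_def by blast
  define x where "x t = crd c (h t)" for t
  define S where "S \<D> = (\<Sum>(t,K)\<in>\<D>. norm (x (Sup K) - x (Inf K)))" for \<D> :: "(real \<times> real set) set"
  \<comment> \<open>The bound keeps the variation \<open>S\<close> of the chosen tagged division, so
    that the pieces are summed before \<open>V\<close> enters; \<open>e\<close> is the error of
    approximating \<open>J i\<close> by a sum.\<close>
  have piece: "\<exists>\<D>. \<D> tagged_division_of {\<tau> i..\<tau> (Suc i)} \<and>
      \<bar>J i - w \<bullet> (x (\<tau> (Suc i)) - x (\<tau> i))\<bar> \<le> 2 * \<eta> * S \<D> + e" if i: "i < n" and e: "e > 0" for i e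
  proof -
    let ?f = "\<lambda>t. form_coeffs \<alpha> (cc i) (crd (cc i) (h t))" and ?h = "\<lambda>t. crd (cc i) (h t)"
    obtain \<delta>1 where \<delta>1: "\<delta>1 > 0"
      "\<And>\<D>. \<D> tagged_division_of {\<tau> i..\<tau> (Suc i)} \<Longrightarrow> (\<lambda>t. ball t \<delta>1) fine \<D> \<Longrightarrow>
       \<bar>(\<Sum>(t,K)\<in>\<D>. ?f t \<bullet> (?h (Sup K) - ?h (Inf K))) - w \<bullet> (x (\<tau> (Suc i)) - x (\<tau> i))\<bar> \<le> 2 * \<eta> * S \<D>"
      unfolding S_def
    proof (rule RS_sums_close[where f = ?f and h = ?h and x = x and w = w and \<eta> = "2 * \<eta>"])
      show "\<tau> i \<le> \<tau> (Suc i)" using \<tau>(3)[OF i] by simp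
      fix s assume s: "s \<in> {\<tau> i..\<tau> (Suc i)}"
      have q: "h s \<in> path_image h" "h s \<in> W" "h s \<in> chart_dom c" "h s \<in> chart_dom (cc i)"
        using s ss[OF i] h(2) \<tau>(5)[OF i] unfolding path_image_def by auto
      obtain U where U: "open U" "h s \<in> U"
        "\<And>z q' q''. z \<in> U \<Longrightarrow> q' \<in> U \<Longrightarrow> q'' \<in> U \<Longrightarrow>
         \<bar>form_coeffs \<alpha> (cc i) (crd (cc i) z) \<bullet> (crd (cc i) q'' - crd (cc i) q')
            - form_coeffs \<alpha> c (crd c (h s)) \<bullet> (crd c q'' - crd c q')\<bar>
         \<le> \<eta> * norm (crd c q'' - crd c q')"
        by (rule form_increment_change[OF A \<alpha> W c \<tau>(4)[OF i] q(2-4) \<eta>]) (rule that)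
      obtain \<delta> where \<delta>: "\<delta> > 0" "\<And>t. t \<in> {0..1} \<Longrightarrow> dist t s < \<delta> \<Longrightarrow> h t \<in> U"
        by (rule continuous_on_delta[OF conth U(1) _ U(2)]) (use s ss[OF i] that in blast)+
      show "\<exists>\<delta>>0. \<forall>t\<in>{\<tau> i..\<tau> (Suc i)} \<inter> ball s \<delta>. \<forall>u\<in>{\<tau> i..\<tau> (Suc i)} \<inter> ball s \<delta>.
          \<forall>v\<in>{\<tau> i..\<tau> (Suc i)} \<inter> ball s \<delta>.
          \<bar>?f t \<bullet> (?h v - ?h u) - w \<bullet> (x v - x u)\<bar> \<le> 2 * \<eta> * norm (x v - x u)"
      proof (intro exI[of _ \<delta>] conjI ballI \<delta>(1))
        fix t u v assume "t \<in> {\<tau> i..\<tau> (Suc i)} \<inter> ball s \<delta>" "u \<in> {\<tau> i..\<tau> (Suc i)} \<inter> ball s \<delta>"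
          "v \<in> {\<tau> i..\<tau> (Suc i)} \<inter> ball s \<delta>"
        hence "h t \<in> U" "h u \<in> U" "h v \<in> U" using \<delta>(2) ss[OF i] by (auto simp: dist_commute)
        hence "\<bar>?f t \<bullet> (?h v - ?h u) - form_coeffs \<alpha> c (crd c (h s)) \<bullet> (x v - x u)\<bar> \<le> \<eta> * norm (x v - x u)"
          using U(3) unfolding x_def by blast
        moreover have "\<bar>(form_coeffs \<alpha> c (crd c (h s)) - w) \<bullet> (x v - x u)\<bar> \<le> \<eta> * norm (x v - x u)"
          using w[OF q(1)] by (intro order_trans[OF Cauchy_Schwarz_ineq2] mult_right_mono) auto
        ultimately show "\<bar>?f t \<bullet> (?h v - ?h u) - w \<bullet> (x v - x u)\<bar> \<le> 2 * \<eta> * norm (x v - x u)"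
          unfolding inner_diff_left by linarith
      qed
    qed (rule that[unfolded S_def])
    obtain \<delta>2 where \<delta>2: "\<delta>2 > 0"
      "\<forall>\<D>. \<D> tagged_division_of {\<tau> i..\<tau> (Suc i)} \<and> (\<lambda>t. ball t \<delta>2) fine \<D> \<longrightarrow>
       \<bar>(\<Sum>(t,K)\<in>\<D>. ?f t \<bullet> (?h (Sup K) - ?h (Inf K))) - J i\<bar> < e"
      using RS[OF i, unfolded has_RS_integral_def, rule_format, OF e] by (elim exE conjE) (rule that)
    \<comment> \<open>One division that is fine enough for both purposes: comparison with
      \<open>w\<close> and approximation of \<open>J i\<close>.\<close>
    have "gauge (\<lambda>t::real. ball t (min \<delta>1 \<delta>2))" using \<delta>1(1) \<delta>2(1) by (intro gauge_ball) auto
    then obtain \<D> where \<D>: "\<D> tagged_division_of {\<tau> i..\<tau> (Suc i)}" "(\<lambda>t. ball t (min \<delta>1 \<delta>2)) fine \<D>"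
      by (rule fine_division_exists_real)
    have "(\<lambda>t. ball t \<delta>1) fine \<D>" "(\<lambda>t. ball t \<delta>2) fine \<D>"
      by (rule fineI, use fineD[OF \<D>(2)] in fastforce)+
    with \<delta>1(2)[OF \<D>(1)] \<delta>2(2)[rule_format, OF conjI, OF \<D>(1)] \<D>(1)
    show ?thesis by (intro exI[of _ \<D>] conjI) linarith+
  qed
  have tel: "(\<Sum>i<n. w \<bullet> (x (\<tau> (Suc i)) - x (\<tau> i))) = w \<bullet> (x 1 - x 0)"
    using sum_lessThan_telescope[of "\<lambda>i. x (\<tau> i)" n] \<tau>(1,2) by (simp flip: inner_sum_right)
  have bound: "\<bar>w \<bullet> (x 1 - x 0)\<bar> \<le> 2 * \<eta> * V + real n * e" if e: "e > 0" for e
  proof -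
    obtain D where D: "\<And>i. i < n \<Longrightarrow> D i tagged_division_of {\<tau> i..\<tau> (Suc i)}"
      "\<And>i. i < n \<Longrightarrow> \<bar>J i - w \<bullet> (x (\<tau> (Suc i)) - x (\<tau> i))\<bar> \<le> 2 * \<eta> * S (D i) + e"
      using piece[OF _ e] by metis
    have SV: "(\<Sum>i<n. S (D i)) \<le> V"
      unfolding S_def
      by (rule variation_over_subdivision[of n \<tau>]) (use D(1) \<tau> V in \<open>auto simp: x_def less_imp_le\<close>)
    have "\<bar>w \<bullet> (x 1 - x 0)\<bar> = \<bar>\<Sum>i<n. J i - w \<bullet> (x (\<tau> (Suc i)) - x (\<tau> i))\<bar>"
      unfolding sum_subtractf tel J[symmetric] by simp
    also have "\<dots> \<le> (\<Sum>i<n. \<bar>J i - w \<bullet> (x (\<tau> (Suc i)) - x (\<tau> i))\<bar>)" by (rule sum_abs)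
    also have "\<dots> \<le> (\<Sum>i<n. 2 * \<eta> * S (D i) + e)" using D(2) by (intro sum_mono) simp
    also have "\<dots> = 2 * \<eta> * (\<Sum>i<n. S (D i)) + real n * e" by (simp add: sum.distrib sum_distrib_left)
    also have "\<dots> \<le> 2 * \<eta> * V + real n * e" using SV \<eta> by simp
    finally show ?thesis .
  qed
  \<comment> \<open>The values \<open>\<tau> 0 = 0\<close> and \<open>\<tau> n = 1\<close> exclude
    an empty subdivision, so an error can be divided evenly among the pieces.\<close>
  have "n \<noteq> 0" using \<tau>(1,2) by (metis zero_neq_one)
  have "\<bar>w \<bullet> (x 1 - x 0)\<bar> \<le> 2 * \<eta> * V"
  proof (rule field_le_epsilon)
    fix e :: real assume "e > 0"
    with bound[of "e / real n"] \<open>n \<noteq> 0\<close> show "\<bar>w \<bullet> (x 1 - x 0)\<bar> \<le> 2 * \<eta> * V + e" by simp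
  qed
  thus ?thesis unfolding x_def pathfinish_def pathstart_def .
qed

section \<open>The two implications\<close>

lemma smooth_atlas_obtain_chart:
  assumes "smooth_atlas A"
  obtains c where "c \<in> A" "p \<in> chart_dom c" "is_chart c"
proof -
  have "p \<in> (\<Union>c\<in>A. chart_dom c)" and "\<forall>c\<in>A. is_chart c"
    using assms unfolding smooth_atlas_def by auto
  thus thesis using that by blast
qed

text \<open>The neighborhood \<open>G\<close> is fixed before the arc is chosen, which allows a
  covering argument afterwards. Its factor \<open>U\<close> comes from the Lavrentiev condition and
  makes lengths finite; the coordinate ball of radius \<open>r / 4\<close> turns length into
  variation.\<close>

lemma legendrian_RS_integral_zero:
  fixes A :: "'a::t2_space chart set"
  assumes A: "smooth_atlas A" and \<xi>: "contact_structure A \<xi>" and \<alpha>: "contact_form_on A \<xi> W \<alpha>" and W: "open W"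
    and g: "riemannian_metric A g" and lav: "locally_lavrentiev (riemannian_dist A g) L"
    and L: "legendrian A \<xi> L" "L \<subseteq> W" and p: "p \<in> L"
  obtains c G where "c \<in> A" "open G" "p \<in> G" "G \<subseteq> chart_dom c"
    "\<And>a b \<gamma>. a < b \<Longrightarrow> continuous_on {a..b} \<gamma> \<Longrightarrow> inj_on \<gamma> {a..b} \<Longrightarrow> \<gamma> ` {a..b} \<subseteq> L \<inter> G \<Longrightarrow>
       has_RS_integral (\<lambda>t. form_coeffs \<alpha> c (crd c (\<gamma> t))) (\<lambda>t. crd c (\<gamma> t)) a b 0"
proof -
  let ?d = "riemannian_dist A g"
  obtain c where c: "c \<in> A" "p \<in> chart_dom c" "is_chart c" by (rule smooth_atlas_obtain_chart[OF A])
  obtain K r where K: "K > 0" and r: "r > 0" and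
    lower: "\<And>q q'. q \<in> chart_dom c \<Longrightarrow> q' \<in> chart_dom c \<Longrightarrow>
       crd c q \<in> ball (crd c p) (r / 4) \<Longrightarrow> crd c q' \<in> ball (crd c p) (r / 4) \<Longrightarrow>
       ennreal (norm (crd c q' - crd c q)) \<le> ennreal K * ?d q q'"
    by (rule riemannian_dist_chart_bounds[OF A g c(1,2)]) (rule that)
  obtain U where U: "open U" "p \<in> U" "lavrentiev ?d (L \<inter> U)"
    using lav p unfolding locally_lavrentiev_def by blast
  hence rect: "rectifiable ?d (L \<inter> U)" unfolding lavrentiev_def C_lavrentiev_def by blast
  let ?N = "chart_dom c \<inter> crd c -` ball (crd c p) (r / 4)"
  show thesis
  proof (rule that[OF c(1), of "U \<inter> ?N"])
    show "open (U \<inter> ?N)" using U(1) open_chart_preimage[OF c(3) open_ball] by blast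
    show "p \<in> U \<inter> ?N" using U(2) c(2) r by simp
    fix a b :: real and \<gamma>
    assume ab: "a < b" and \<gamma>: "continuous_on {a..b} \<gamma>" "inj_on \<gamma> {a..b}" "\<gamma> ` {a..b} \<subseteq> L \<inter> (U \<inter> ?N)"
    have N: "\<gamma> t \<in> L" "\<gamma> t \<in> chart_dom c" "crd c (\<gamma> t) \<in> ball (crd c p) (r / 4)" if "t \<in> {a..b}" for t
      using \<gamma>(3) that by blast+
    define x where "x t = crd c (\<gamma> t)" for t
    define V where "V = enn2real (ennreal K * curve_length ?d (\<gamma> ` {a..b}))"
    have "compact_subarc (L \<inter> U) (\<gamma> ` {a..b})"
      unfolding compact_subarc_def using \<gamma>(3) arc_reparametrization[OF ab \<gamma>(1,2)] by blast
    hence "curve_length ?d (\<gamma> ` {a..b}) < \<infinity>" using rect unfolding rectifiable_def by blast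
    hence V: "ennreal V = ennreal K * curve_length ?d (\<gamma> ` {a..b})" "V \<ge> 0"
      unfolding V_def by (auto simp: ennreal_mult_less_top intro!: ennreal_enn2real)
    have var: "(\<Sum>k\<in>\<D>. norm (x (Sup k) - x (Inf k))) \<le> V" if \<D>: "\<D> division_of {a..b}" for \<D>
    proof -
      have "ennreal (\<Sum>k\<in>\<D>. norm (x (Sup k) - x (Inf k))) \<le> ennreal V"
        unfolding V(1)
        by (rule variation_le_curve_length[OF ab \<gamma>(1,2) \<D>]) (use N lower in \<open>simp add: x_def\<close>)
      thus ?thesis using V(2) by simp
    qed
    show "has_RS_integral (\<lambda>t. form_coeffs \<alpha> c (crd c (\<gamma> t))) (\<lambda>t. crd c (\<gamma> t)) a b 0"
      unfolding has_RS_integral_def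
    proof (intro allI impI)
      fix \<epsilon> :: real assume \<epsilon>: "\<epsilon> > 0"
      \<comment> \<open>The added 1 covers \<open>V = 0\<close> and makes
        \<open>\<eta> * V < \<epsilon>\<close> strict.\<close>
      define \<eta> where "\<eta> = \<epsilon> / (V + 1)"
      have \<eta>: "\<eta> > 0" "\<eta> * V < \<epsilon>" using \<epsilon> V(2) unfolding \<eta>_def by (auto simp: field_simps)
      let ?f = "\<lambda>t. form_coeffs \<alpha> c (crd c (\<gamma> t))"
      obtain \<delta> where \<delta>: "\<delta> > 0"
        "\<And>\<D>. \<D> tagged_division_of {a..b} \<Longrightarrow> (\<lambda>t. ball t \<delta>) fine \<D> \<Longrightarrow>
          \<bar>(\<Sum>(t,K)\<in>\<D>. ?f t \<bullet> (x (Sup K) - x (Inf K))) - 0 \<bullet> (x b - x a)\<bar>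
          \<le> \<eta> * (\<Sum>(t,K)\<in>\<D>. norm (x (Sup K) - x (Inf K)))"
      proof (rule RS_sums_close[where f = ?f and h = x and x = x and w = 0 and \<eta> = \<eta> and a = a and b = b])
        show "a \<le> b" using ab by simp
        fix s assume s: "s \<in> {a..b}"
        obtain U' where U': "open U'" "\<gamma> s \<in> U'" "U' \<subseteq> W \<inter> chart_dom c"
          "\<And>q q' q''. q \<in> U' \<Longrightarrow> q' \<in> L \<inter> U' \<Longrightarrow> q'' \<in> L \<inter> U' \<Longrightarrow>
            \<bar>form_coeffs \<alpha> c (crd c q) \<bullet> (crd c q'' - crd c q')\<bar> \<le> \<eta> * norm (crd c q'' - crd c q')"
          by (rule legendrian_imp_form_small[OF A \<xi> \<alpha> W L(1) N(1)[OF s] _ c(1) N(2)[OF s] \<eta>(1)])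
            (use N(1)[OF s] L(2) in blast, rule that)
        obtain \<delta> where \<delta>: "\<delta> > 0" "\<And>t. t \<in> {a..b} \<Longrightarrow> dist t s < \<delta> \<Longrightarrow> \<gamma> t \<in> U'"
          by (rule continuous_on_delta[OF \<gamma>(1) U'(1) s U'(2)]) (rule that)
        show "\<exists>\<delta>>0. \<forall>t\<in>{a..b} \<inter> ball s \<delta>. \<forall>u\<in>{a..b} \<inter> ball s \<delta>. \<forall>v\<in>{a..b} \<inter> ball s \<delta>.
          \<bar>?f t \<bullet> (x v - x u) - 0 \<bullet> (x v - x u)\<bar> \<le> \<eta> * norm (x v - x u)"
        proof (intro exI[of _ \<delta>] conjI ballI \<delta>(1))
          fix t u v assume "t \<in> {a..b} \<inter> ball s \<delta>" "u \<in> {a..b} \<inter> ball s \<delta>" "v \<in> {a..b} \<inter> ball s \<delta>"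
          hence "\<gamma> t \<in> U'" "\<gamma> u \<in> L \<inter> U'" "\<gamma> v \<in> L \<inter> U'" using \<delta>(2) N(1) by (auto simp: dist_commute)
          thus "\<bar>?f t \<bullet> (x v - x u) - 0 \<bullet> (x v - x u)\<bar> \<le> \<eta> * norm (x v - x u)"
            using U'(4) unfolding x_def by simp
        qed
      qed (rule that)
      show "\<exists>\<delta>>0. \<forall>\<D>. \<D> tagged_division_of {a..b} \<and> (\<lambda>t. ball t \<delta>) fine \<D> \<longrightarrow>
        \<bar>(\<Sum>(t,K)\<in>\<D>. ?f t \<bullet> (crd c (\<gamma> (Sup K)) - crd c (\<gamma> (Inf K)))) - 0\<bar> < \<epsilon>"
      proof (intro exI[of _ \<delta>] conjI allI impI \<delta>(1))
        fix \<D> assume \<D>: "\<D> tagged_division_of {a..b} \<and> (\<lambda>t. ball t \<delta>) fine \<D>"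
        \<comment> \<open>The interval is viewed as a subdivision with a single piece.\<close>
        have "(\<Sum>i<1::nat. \<Sum>(t,K)\<in>\<D>. norm (x (Sup K) - x (Inf K))) \<le> V"
          by (rule variation_over_subdivision[where \<tau> = "\<lambda>i. if i = 0 then a else b"])
            (use \<D> var ab in auto)
        hence "\<eta> * (\<Sum>(t,K)\<in>\<D>. norm (x (Sup K) - x (Inf K))) \<le> \<eta> * V" using \<eta>(1) by simp
        with \<delta>(2)[of \<D>] \<D> \<eta>(2) show "\<bar>(\<Sum>(t,K)\<in>\<D>. ?f t \<bullet> (crd c (\<gamma> (Sup K)) - crd c (\<gamma> (Inf K)))) - 0\<bar> < \<epsilon>"
          unfolding x_def by simp
      qed
    qed
  qed auto
qed

text \<open>A Lebesgue number gives a mesh for which each piece of an equidistant subdivision stays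
  in one neighborhood where partial integrals vanish, and so in one chart.\<close>

lemma legendrian_imp_form_integral_zero:
  fixes A :: "'a::t2_space chart set"
  assumes A: "smooth_atlas A" and \<xi>: "contact_structure A \<xi>" and \<alpha>: "contact_form_on A \<xi> W \<alpha>" and W: "open W"
    and g: "riemannian_metric A g" and lav: "locally_lavrentiev (riemannian_dist A g) L"
    and L: "legendrian A \<xi> L" "L \<subseteq> W" and \<gamma>: "arc \<gamma>" "path_image \<gamma> \<subseteq> L"
  shows "has_form_integral A \<alpha> \<gamma> 0"
proof -
  have cont: "continuous_on {0..1} \<gamma>" and inj: "inj_on \<gamma> {0..1}"
    using \<gamma>(1) unfolding arc_def path_def by auto
  \<comment> \<open>All subintervals are included because the pieces are known only once the mesh
    has been chosen.\<close>
  define good where "good c G \<longleftrightarrow> c \<in> A \<and> open G \<and> G \<subseteq> chart_dom c \<and>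
    (\<forall>a b. a < b \<longrightarrow> {a..b} \<subseteq> {0..1} \<longrightarrow> \<gamma> ` {a..b} \<subseteq> L \<inter> G \<longrightarrow>
       has_RS_integral (\<lambda>t. form_coeffs \<alpha> c (crd c (\<gamma> t))) (\<lambda>t. crd c (\<gamma> t)) a b 0)" for c G
  have "\<exists>e c G. e > 0 \<and> good c G \<and> \<gamma> ` ({0..1} \<inter> ball t e) \<subseteq> G" if t: "t \<in> {0..1}" for t
  proof -
    have "\<gamma> t \<in> L" using t \<gamma>(2) unfolding path_image_def by blast
    then obtain c G where G: "c \<in> A" "open G" "\<gamma> t \<in> G" "G \<subseteq> chart_dom c"
      "\<And>a b \<gamma>. a < b \<Longrightarrow> continuous_on {a..b} \<gamma> \<Longrightarrow> inj_on \<gamma> {a..b} \<Longrightarrow> \<gamma> ` {a..b} \<subseteq> L \<inter> G \<Longrightarrow>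
       has_RS_integral (\<lambda>t. form_coeffs \<alpha> c (crd c (\<gamma> t))) (\<lambda>t. crd c (\<gamma> t)) a b 0"
      by (rule legendrian_RS_integral_zero[OF A \<xi> \<alpha> W g lav L]) (rule that)
    have "good c G"
      unfolding good_def using G(1,2,4,5) cont inj by (meson continuous_on_subset inj_on_subset)
    moreover obtain e where "e > 0" "\<And>s. s \<in> {0..1} \<Longrightarrow> dist s t < e \<Longrightarrow> \<gamma> s \<in> G"
      by (rule continuous_on_delta[OF cont G(2) t G(3)]) (rule that)
    ultimately show ?thesis by (intro exI[of _ e] exI[of _ c] exI[of _ G]) (auto simp: dist_commute)
  qed
  then obtain e where e: "\<And>t. t \<in> {0..1} \<Longrightarrow> e t > 0"
    "\<And>t. t \<in> {0..1} \<Longrightarrow> \<exists>c G. good c G \<and> \<gamma> ` ({0..1} \<inter> ball t (e t)) \<subseteq> G"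
    by metis
  obtain \<delta> where \<delta>: "\<delta> > 0" "\<And>t. t \<in> {0..1} \<Longrightarrow> \<exists>s\<in>{0..1}. ball t \<delta> \<subseteq> ball s (e s)"
  proof (rule Heine_Borel_lemma[of "{0..1}" "(\<lambda>s. ball s (e s)) ` {0..1::real}"])
    show "{0..1} \<subseteq> \<Union> ((\<lambda>s. ball s (e s)) ` {0..1})" using e(1) by force
  qed (auto intro: that)
  obtain n where n: "n \<noteq> 0" "inverse (real n) < \<delta>" using \<delta>(1) real_arch_inverse by blast
  define \<tau> where "\<tau> i = real i / real n" for i
  have \<tau>: "\<tau> 0 = 0" "\<tau> n = 1" "\<tau> i < \<tau> (Suc i)" for i
    using n(1) unfolding \<tau>_def by (auto simp: divide_strict_right_mono)
  have \<tau>01: "{\<tau> i..\<tau> (Suc i)} \<subseteq> {0..1}" if "i < n" for i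
    using that unfolding \<tau>_def by (auto simp: field_simps)
  have "\<exists>c G. good c G \<and> \<gamma> ` {\<tau> i..\<tau> (Suc i)} \<subseteq> G" if i: "i < n" for i
  proof -
    have "\<tau> i \<in> {0..1}" using \<tau>01[OF i] \<tau>(3)[of i] by auto
    then obtain s where s: "s \<in> {0..1}" "ball (\<tau> i) \<delta> \<subseteq> ball s (e s)" using \<delta>(2) by blast
    have "\<tau> (Suc i) - \<tau> i < \<delta>" using n unfolding \<tau>_def by (simp add: field_simps)
    hence "{\<tau> i..\<tau> (Suc i)} \<subseteq> ball (\<tau> i) \<delta>" by (auto simp: dist_real_def)
    thus ?thesis using e(2)[OF s(1)] s(2) \<tau>01[OF i] by blast
  qed
  then obtain c where c: "\<And>i. i < n \<Longrightarrow> \<exists>G. good (c i) G \<and> \<gamma> ` {\<tau> i..\<tau> (Suc i)} \<subseteq> G" by metis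
  have sub: "chart_subdivision A \<gamma> n \<tau> c"
    unfolding chart_subdivision_def using \<tau> c unfolding good_def by blast
  have RS: "has_RS_integral (\<lambda>t. form_coeffs \<alpha> (c i) (crd (c i) (\<gamma> t))) (\<lambda>t. crd (c i) (\<gamma> t)) (\<tau> i) (\<tau> (Suc i)) 0"
    if i: "i < n" for i
  proof -
    have "\<gamma> ` {\<tau> i..\<tau> (Suc i)} \<subseteq> L" using \<gamma>(2) \<tau>01[OF i] unfolding path_image_def by blast
    thus ?thesis using c[OF i] \<tau>(3) \<tau>01[OF i] unfolding good_def by blast
  qed
  show ?thesis
    unfolding has_form_integral_def
    by (intro exI[of _ n] exI[of _ \<tau>] exI[of _ c] exI[of _ "\<lambda>_. 0"] conjI sub) (simp_all add: RS)
qed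

lemma form_small_of_form_integrals_zero:
  fixes A :: "'a::t2_space chart set"
  assumes A: "smooth_atlas A" and \<alpha>: "smooth_one_form_on A W \<alpha>" and W: "open W"
    and g: "riemannian_metric A g" and lav: "locally_lavrentiev (riemannian_dist A g) L"
    and int: "\<And>\<gamma>. arc \<gamma> \<Longrightarrow> path_image \<gamma> \<subseteq> L \<Longrightarrow> has_form_integral A \<alpha> \<gamma> 0"
    and p: "p \<in> L" "p \<in> W" and c: "c \<in> A" "p \<in> chart_dom c" and \<eta>: "\<eta> > 0"
  obtains U where "open U" "p \<in> U" "U \<subseteq> chart_dom c"
    "\<And>q' q''. q' \<in> L \<inter> U \<Longrightarrow> q'' \<in> L \<inter> U \<Longrightarrow>
       \<bar>form_coeffs \<alpha> c (crd c p) \<bullet> (crd c q'' - crd c q')\<bar> \<le> \<eta> * norm (crd c q'' - crd c q')"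
proof -
  let ?d = "riemannian_dist A g" and ?x = "crd c" and ?xp = "crd c p"
  have chart: "is_chart c" using A c(1) unfolding smooth_atlas_def by blast
  obtain K r where K: "K > 0" and r: "r > 0" "cball ?xp r \<subseteq> ?x ` chart_dom c" and
    stay: "\<And>\<rho> q q'. 0 < \<rho> \<Longrightarrow> \<rho> \<le> r \<Longrightarrow> q \<in> chart_dom c \<Longrightarrow> ?x q \<in> ball ?xp (\<rho> / 2) \<Longrightarrow>
       ?d q q' < ennreal (\<rho> / (2 * K)) \<Longrightarrow> q' \<in> chart_dom c \<and> ?x q' \<in> ball ?xp \<rho>" and
    lower: "\<And>q q'. q \<in> chart_dom c \<Longrightarrow> q' \<in> chart_dom c \<Longrightarrow>
       ?x q \<in> ball ?xp (r / 4) \<Longrightarrow> ?x q' \<in> ball ?xp (r / 4) \<Longrightarrow>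
       ennreal (norm (?x q' - ?x q)) \<le> ennreal K * ?d q q'" and
    upper: "\<And>q q'. q \<in> chart_dom c \<Longrightarrow> q' \<in> chart_dom c \<Longrightarrow> ?x q \<in> ball ?xp r \<Longrightarrow> ?x q' \<in> ball ?xp r \<Longrightarrow>
       ?d q q' \<le> ennreal (K * norm (?x q' - ?x q))"
    by (rule riemannian_dist_chart_bounds[OF A g c]) (rule that)
  obtain U0 C0 where U0: "open U0" "p \<in> U0" "C_lavrentiev C0 ?d (L \<inter> U0)"
    using lav p(1) unfolding locally_lavrentiev_def lavrentiev_def by blast
  \<comment> \<open>The Lavrentiev constant is an arbitrary real; the maximum makes it positive, so
    that dividing by it is safe.\<close>
  define C where "C = max C0 1"
  have C: "C > 0" "C0 \<le> C" unfolding C_def by auto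
  define \<eta>' where "\<eta>' = \<eta> / (2 * (K * (C * K)))"
  have \<eta>': "\<eta>' > 0" "2 * \<eta>' * (K * (C * K)) = \<eta>" using \<eta> K C(1) unfolding \<eta>'_def by auto
  obtain U1 where U1: "open U1" "p \<in> U1" "U1 \<subseteq> W \<inter> chart_dom c"
    "\<And>q. q \<in> U1 \<Longrightarrow> norm (form_coeffs \<alpha> c (?x q) - form_coeffs \<alpha> c ?xp) < \<eta>'"
    by (rule form_coeffs_near[OF \<alpha> c(1) chart W p(2) c(2) \<eta>'(1)]) (rule that)
  have "open (?x ` (U1 \<inter> chart_dom c))" by (rule open_chart_image[OF chart U1(1)])
  moreover have "?xp \<in> ?x ` (U1 \<inter> chart_dom c)" using U1(2) c(2) by blast
  ultimately obtain \<rho>0 where \<rho>0: "\<rho>0 > 0" "ball ?xp \<rho>0 \<subseteq> ?x ` (U1 \<inter> chart_dom c)" by (rule openE)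
  \<comment> \<open>Within \<rho>0 the coefficients stay within \<eta>' of those at
    \<open>p\<close>; within \<open>r / 4\<close> distance bounds coordinate increments.\<close>
  define \<rho> where "\<rho> = min \<rho>0 (r / 4)"
  have \<rho>: "\<rho> > 0" "\<rho> \<le> \<rho>0" "\<rho> \<le> r / 4" "\<rho> \<le> r" using \<rho>0(1) r(1) unfolding \<rho>_def by auto
  have inU1: "q \<in> U1" if "q \<in> chart_dom c" "?x q \<in> ball ?xp \<rho>" for q
  proof -
    have "?x q \<in> ?x ` (U1 \<inter> chart_dom c)" using that(2) \<rho>0(2) \<rho>(2) by force
    then obtain q0 where "q0 \<in> U1" "q0 \<in> chart_dom c" "?x q = ?x q0" by blast
    thus ?thesis using inj_onD[OF chartD(5)[OF chart]] that(1) by metis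
  qed
  \<comment> \<open>Endpoints in the ball of radius \<sigma> are less than
    \<open>2 * \<sigma>\<close> apart, so the subarc is shorter than \<open>\<rho> / (2 * K)\<close>
    and cannot leave the ball of radius \<rho>; \<open>\<rho> / 2\<close> is the condition on its
    start.\<close>
  define \<sigma> where "\<sigma> = min (\<rho> / 2) (\<rho> / (4 * (K * (C * K))))"
  have \<sigma>: "\<sigma> > 0" "\<sigma> \<le> \<rho> / 2" "C * K * (2 * \<sigma>) \<le> \<rho> / (2 * K)"
  proof -
    show "\<sigma> > 0" "\<sigma> \<le> \<rho> / 2" using \<rho>(1) K C(1) unfolding \<sigma>_def by auto
    have "C * K * (2 * \<sigma>) \<le> C * K * (2 * (\<rho> / (4 * (K * (C * K)))))"
      using K C(1) unfolding \<sigma>_def by (intro mult_left_mono) auto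
    also have "\<dots> = \<rho> / (2 * K)" using K C(1) by (simp add: field_simps)
    finally show "C * K * (2 * \<sigma>) \<le> \<rho> / (2 * K)" .
  qed
  let ?U = "U0 \<inter> (chart_dom c \<inter> ?x -` ball ?xp \<sigma>)"
  show thesis
  proof (rule that[of ?U])
    show "open ?U" using U0(1) open_chart_preimage[OF chart open_ball] by blast
    show "p \<in> ?U" using U0(2) c(2) \<sigma>(1) by simp
    show "?U \<subseteq> chart_dom c" by blast
    fix q' q'' assume q: "q' \<in> L \<inter> ?U" "q'' \<in> L \<inter> ?U"
    let ?n = "norm (?x q'' - ?x q')"
    show "\<bar>form_coeffs \<alpha> c ?xp \<bullet> (?x q'' - ?x q')\<bar> \<le> \<eta> * ?n"
    proof (cases "q' = q''")
      case False
      obtain \<gamma> where \<gamma>: "shortest_subarc ?d (L \<inter> U0) q' q'' \<gamma>" "curve_length ?d \<gamma> \<le> ennreal C0 * ?d q' q''"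
        using U0(3) q unfolding C_lavrentiev_def by blast
      obtain h where h: "arc h" "path_image h = \<gamma>" "pathstart h = q'" "pathfinish h = q''" "\<gamma> \<subseteq> L"
        using \<gamma>(1) False unfolding shortest_subarc_def subarc_joining_def by auto
      have cont: "continuous_on {0..1} h" and inj: "inj_on h {0..1}" and im: "path_image h = h ` {0..1}"
        using h(1) unfolding arc_def path_def path_image_def by auto
      have "curve_length ?d \<gamma> \<le> ennreal C * ennreal (K * ?n)"
      proof (rule order_trans[OF \<gamma>(2) mult_mono])
        show "?d q' q'' \<le> ennreal (K * ?n)"
          using q \<sigma>(2) \<rho> by (intro upper) auto
      qed (use C(2) in \<open>auto intro: ennreal_leI\<close>)
      also have "\<dots> = ennreal (C * (K * ?n))" using C(1) K by (simp add: ennreal_mult)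
      finally have len: "curve_length ?d (path_image h) \<le> ennreal (C * (K * ?n))" unfolding h(2) .
      have "?n < 2 * \<sigma>"
        using q dist_triangle2[of "?x q''" "?x q'" ?xp] by (auto simp: dist_norm norm_minus_commute)
      hence "C * (K * ?n) < C * K * (2 * \<sigma>)" using C(1) K by (simp flip: mult.assoc)
      hence short: "C * (K * ?n) < \<rho> / (2 * K)" using \<sigma>(3) by linarith
      \<comment> \<open>The subarc lies in \<open>L \<inter> U0\<close>, which may leave the chart,
        but its points are no farther from \<open>q'\<close> than its length. The start is separate
        because that estimate is for positive parameters.\<close>
      have near: "h t \<in> chart_dom c \<and> ?x (h t) \<in> ball ?xp \<rho>" if t: "t \<in> {0..1}" for t
      proof (cases "t = 0")
        case True
        thus ?thesis using q(1) h(3) \<sigma>(2) \<rho>(1) unfolding pathstart_def by auto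
      next
        case False
        have "?d q' (h t) \<le> curve_length ?d (path_image h)"
          using curve_length_ge_dist_start[OF h(1), of t ?d] False t unfolding h(3) by auto
        also have "\<dots> \<le> ennreal (C * (K * ?n))" by (rule len)
        also have "\<dots> < ennreal (\<rho> / (2 * K))" using short C(1) K by (intro ennreal_lessI) (auto intro: order_le_less_trans[rotated])
        finally show ?thesis using q(1) \<sigma>(2) \<rho>(1) by (intro stay[OF \<rho>(1,4)]) auto
      qed
      have var: "(\<Sum>k\<in>\<D>. norm (?x (h (Sup k)) - ?x (h (Inf k)))) \<le> K * (C * (K * ?n))"
        if \<D>: "\<D> division_of {0..1}" for \<D>
      proof -
        have "ennreal (\<Sum>k\<in>\<D>. norm (?x (h (Sup k)) - ?x (h (Inf k)))) \<le> ennreal K * curve_length ?d (h ` {0..1})"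
        proof (rule variation_le_curve_length[OF _ cont inj \<D>])
          fix t t' :: real assume "t \<in> {0..1}" "t' \<in> {0..1}"
          thus "ennreal (norm (?x (h t') - ?x (h t))) \<le> ennreal K * ?d (h t) (h t')"
            using near[of t] near[of t'] \<rho>(3) by (intro lower) auto
        qed simp
        also have "\<dots> \<le> ennreal K * ennreal (C * (K * ?n))"
          using len unfolding im by (intro mult_left_mono) auto
        also have "\<dots> = ennreal (K * (C * (K * ?n)))" using C(1) K by (simp add: ennreal_mult)
        finally show ?thesis using C(1) K by (subst (asm) ennreal_le_iff) auto
      qed
      have "\<bar>form_coeffs \<alpha> c ?xp \<bullet> (?x (pathfinish h) - ?x (pathstart h))\<bar> \<le> 2 * \<eta>' * (K * (C * (K * ?n)))"
      proof (rule form_integral_zero_estimate[OF A \<alpha> W c(1) h(1) _ _ \<eta>'(1)])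
        show "path_image h \<subseteq> W \<inter> chart_dom c"
          using near inU1 U1(3) unfolding im by blast
        show "has_form_integral A \<alpha> h 0" using int h by blast
        fix q assume "q \<in> path_image h"
        hence "q \<in> U1" using near inU1 unfolding im by blast
        thus "norm (form_coeffs \<alpha> c (?x q) - form_coeffs \<alpha> c ?xp) \<le> \<eta>'" using U1(4) less_imp_le by blast
      qed (rule var)
      also have "\<dots> = (2 * \<eta>' * (K * (C * K))) * ?n" by (simp add: mult.assoc)
      also have "\<dots> = \<eta> * ?n" unfolding \<eta>'(2) ..
      finally show ?thesis unfolding h(3,4) .
    qed simp
  qed
qed

text \<open>For the increments \<open>?y\<close> in \<open>c\<close> and \<open>?x\<close> in the
  atlas chart, \<open>b \<bullet> ?y\<close> differs from \<open>?a \<bullet> ?x\<close> by the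
  linearization error of the transition map, and \<open>norm ?x\<close> is at most a multiple of
  \<open>norm ?y\<close>; smallness relative to \<open>?x\<close> thus becomes a small angle in
  \<open>c\<close>.\<close>

lemma legendrian_of_form_small:
  assumes A: "smooth_atlas A" and \<xi>: "contact_structure A \<xi>" and \<alpha>: "contact_form_on A \<xi> W \<alpha>" and L: "L \<subseteq> W"
    and small: "\<And>p c \<eta>. p \<in> L \<Longrightarrow> c \<in> A \<Longrightarrow> p \<in> chart_dom c \<Longrightarrow> \<eta> > 0 \<Longrightarrow>
      \<exists>U. open U \<and> p \<in> U \<and> U \<subseteq> chart_dom c \<and> (\<forall>q'\<in>L \<inter> U. \<forall>q''\<in>L \<inter> U.
       \<bar>form_coeffs \<alpha> c (crd c p) \<bullet> (crd c q'' - crd c q')\<bar> \<le> \<eta> * norm (crd c q'' - crd c q'))"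
  shows "legendrian A \<xi> L"
  unfolding legendrian_def
proof (intro ballI allI impI, elim conjE)
  fix p c and \<epsilon> :: real
  assume p: "p \<in> L" and c: "C1_coordinates A c" "p \<in> chart_dom c" and \<epsilon>: "\<epsilon> > 0"
  obtain c0 where c0: "c0 \<in> A" "p \<in> chart_dom c0" "is_chart c0" by (rule smooth_atlas_obtain_chart[OF A])
  have chart_c: "is_chart c" and compat: "Ck_compatible 1 c c0"
    using c(1) c0(1) unfolding C1_coordinates_def by auto
  interpret chart_pair c0 c by (rule chart_pair.intro[OF c0(3) chart_c Ck_compatible_sym[OF compat]])
  interpret s: chart_pair c c0 by (rule swap)
  let ?T = "dtrans c0 c p" and ?a = "form_coeffs \<alpha> c0 (crd c0 p)"
  have pW: "p \<in> W" using p L by blast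
  obtain b where b: "b \<noteq> 0" "components c ` \<xi> p = {v. b \<bullet> v = 0}" "\<And>v. b \<bullet> ?T v = ?a \<bullet> v"
    by (rule components_contact_plane[OF A \<xi> \<alpha> c0(1) c(1) pW c0(2) c(2)]) (rule that)
  obtain B where B: "B > 0" "\<And>v. norm (dtrans c c0 p v) \<le> B * norm v"
    using linear_bounded_pos[OF s.linear_dtrans[OF c(2) c0(2)]] by blast
  define \<epsilon>' where "\<epsilon>' = min \<epsilon> 1"
  have \<epsilon>': "\<epsilon>' > 0" "\<epsilon>' \<le> 1" "\<epsilon>' \<le> \<epsilon>" using \<epsilon> unfolding \<epsilon>'_def by auto
  define \<kappa> where "\<kappa> = sin (\<epsilon>' / 2) * norm b"
  have "sin (\<epsilon>' / 2) > 0" using \<epsilon>' pi_gt3 by (intro sin_gt_zero) linarith+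
  hence \<kappa>: "\<kappa> > 0" using b(1) unfolding \<kappa>_def by simp
  \<comment> \<open>Form and linearization each contribute
    \<open>\<kappa> / (4 * B) * norm ?x\<close>; by \<open>norm ?x \<le> 2 * B * norm ?y\<close> the
    total is at most \<open>\<kappa> * norm ?y\<close>. The first entry of the minimum lets half of
    \<open>norm ?x\<close> be absorbed in the proof of that inequality.\<close>
  define \<eta> \<eta>1 where "\<eta> = \<kappa> / (4 * B)" and "\<eta>1 = min (1 / (2 * B)) (\<kappa> / (4 * B * norm b))"
  have \<eta>: "\<eta> > 0" "\<eta>1 > 0" "B * \<eta>1 \<le> 1 / 2" "norm b * \<eta>1 \<le> \<kappa> / (4 * B)"
  proof -
    show "\<eta> > 0" "\<eta>1 > 0" using \<kappa> B(1) b(1) unfolding \<eta>_def \<eta>1_def by auto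
    have "B * \<eta>1 \<le> B * (1 / (2 * B))" using B(1) unfolding \<eta>1_def by (intro mult_left_mono) auto
    thus "B * \<eta>1 \<le> 1 / 2" using B(1) by simp
    have "norm b * \<eta>1 \<le> norm b * (\<kappa> / (4 * B * norm b))" unfolding \<eta>1_def by (intro mult_left_mono) auto
    thus "norm b * \<eta>1 \<le> \<kappa> / (4 * B)" using b(1) by simp
  qed
  obtain U1 where U1: "open U1" "p \<in> U1" "U1 \<subseteq> chart_dom c0"
    "\<forall>q'\<in>L \<inter> U1. \<forall>q''\<in>L \<inter> U1. \<bar>?a \<bullet> (crd c0 q'' - crd c0 q')\<bar> \<le> \<eta> * norm (crd c0 q'' - crd c0 q')"
    using small[OF p c0(1,2) \<eta>(1)] by (elim exE conjE) (rule that)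
  have crd_p: "crd c0 p \<in> crd c0 ` (chart_dom c0 \<inter> chart_dom c)" using c0(2) c(2) by blast
  obtain \<delta> where \<delta>: "\<delta> > 0" "ball (crd c0 p) \<delta> \<subseteq> crd c0 ` (chart_dom c0 \<inter> chart_dom c)"
    "\<And>x y. x \<in> ball (crd c0 p) \<delta> \<Longrightarrow> y \<in> ball (crd c0 p) \<delta> \<Longrightarrow>
       norm (transition c0 c y - transition c0 c x - ?T (y - x)) \<le> \<eta>1 * norm (y - x)"
    by (rule C1_strict_derivative[OF C1_trans open_overlap crd_p \<eta>(2)]) (rule that)
  let ?U = "chart_dom c \<inter> (U1 \<inter> (chart_dom c0 \<inter> crd c0 -` ball (crd c0 p) \<delta>))"
  show "\<exists>U. open U \<and> p \<in> U \<and> U \<subseteq> chart_dom c \<and> (\<forall>p'\<in>L \<inter> U. \<forall>p''\<in>L \<inter> U. p' \<noteq> p'' \<longrightarrow>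
      angle_to_plane (crd c p'' - crd c p') (components c ` \<xi> p) < \<epsilon>)"
  proof (intro exI[of _ ?U] conjI ballI impI)
    show "open ?U"
      using chartD(1)[OF chart_c] U1(1) open_chart_preimage[OF c0(3) open_ball] by blast
    show "p \<in> ?U" using c(2) U1(2) c0(2) \<delta>(1) by simp
    show "?U \<subseteq> chart_dom c" by blast
    fix q' q'' assume q: "q' \<in> L \<inter> ?U" "q'' \<in> L \<inter> ?U" "q' \<noteq> q''"
    let ?x = "crd c0 q'' - crd c0 q'" and ?y = "crd c q'' - crd c q'"
    have 1: "norm (?y - ?T ?x) \<le> \<eta>1 * norm ?x"
      using \<delta>(3)[of "crd c0 q'" "crd c0 q''"] q trans_crd[of q'] trans_crd[of q''] by simp
    have "norm ?x = norm (dtrans c c0 p (?T ?x))" using dtrans_inverse[OF c0(2) c(2)] by simp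
    also have "\<dots> \<le> B * norm (?T ?x)" by (rule B(2))
    also have "\<dots> \<le> B * (norm ?y + \<eta>1 * norm ?x)"
      using 1 norm_triangle_ineq4[of ?y "?y - ?T ?x"] B(1) by (intro mult_left_mono) auto
    also have "\<dots> \<le> B * norm ?y + 1 / 2 * norm ?x"
      using mult_right_mono[OF \<eta>(3), of "norm ?x"] by (simp add: algebra_simps)
    finally have x: "norm ?x \<le> 2 * B * norm ?y" by simp
    have "\<bar>b \<bullet> (?y - ?T ?x)\<bar> \<le> norm b * (\<eta>1 * norm ?x)"
      by (intro order_trans[OF Cauchy_Schwarz_ineq2] mult_left_mono 1) simp
    also have "\<dots> \<le> \<kappa> / (4 * B) * norm ?x"
      using mult_right_mono[OF \<eta>(4), of "norm ?x"] by (simp add: mult.assoc)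
    finally have 2: "\<bar>b \<bullet> (?y - ?T ?x)\<bar> \<le> \<kappa> / (4 * B) * norm ?x" .
    have "\<bar>?a \<bullet> ?x\<bar> \<le> \<kappa> / (4 * B) * norm ?x"
      using U1(4) q unfolding \<eta>_def by blast
    moreover have "b \<bullet> ?y = b \<bullet> (?y - ?T ?x) + ?a \<bullet> ?x" by (simp add: inner_diff_right b(3))
    ultimately have "\<bar>b \<bullet> ?y\<bar> \<le> \<kappa> / (4 * B) * norm ?x + \<kappa> / (4 * B) * norm ?x" using 2 by linarith
    also have "\<dots> = \<kappa> / (2 * B) * norm ?x" by (simp add: field_simps)
    also have "\<dots> \<le> \<kappa> / (2 * B) * (2 * B * norm ?y)"
      using x \<kappa> B(1) by (intro mult_left_mono) auto
    also have "\<dots> = sin (\<epsilon>' / 2) * (norm b * norm ?y)" using B(1) unfolding \<kappa>_def by simp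
    finally have "\<bar>b \<bullet> ?y\<bar> \<le> sin (\<epsilon>' / 2) * (norm b * norm ?y)" .
    moreover have "?y \<noteq> 0" using inj_onD[OF chartD(5)[OF chart_c], of q'' q'] q by auto
    ultimately have "angle_to_plane ?y {v. b \<bullet> v = 0} < \<epsilon>'"
      by (intro angle_less_of_inner_le[OF b(1) _ \<epsilon>'(1,2)])
    thus "angle_to_plane ?y (components c ` \<xi> p) < \<epsilon>" unfolding b(2) using \<epsilon>'(3) by linarith
  qed
qed

theorem proposition3p8:
  fixes A :: "'a::{t2_space, second_countable_topology} chart set"
    and \<xi> :: "'a \<Rightarrow> 'a tvec set"
    and L W :: "'a set"
    and \<alpha> :: "'a \<Rightarrow> 'a tvec \<Rightarrow> real"
  assumes "smooth_atlas A"
    and "contact_structure A \<xi>"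
    and "locally_lavrentiev_in A L"
    and "open W" and "L \<subseteq> W" and "contact_form_on A \<xi> W \<alpha>"
  shows "legendrian A \<xi> L \<longleftrightarrow>
    (\<forall>\<gamma>. arc \<gamma> \<and> path_image \<gamma> \<subseteq> L \<longrightarrow> has_form_integral A \<alpha> \<gamma> 0)"
proof -
  \<comment> \<open>Neither side of the equivalence mentions a metric, so any witness of the local
    Lavrentiev property serves for both directions.\<close>
  obtain g where g: "riemannian_metric A g" "locally_lavrentiev (riemannian_dist A g) L"
    using assms(3) unfolding locally_lavrentiev_in_def by blast
  have \<alpha>: "smooth_one_form_on A W \<alpha>" using assms(6) unfolding contact_form_on_def by blast
  show ?thesis
  proof (intro iffI allI impI)
    fix \<gamma> assume "legendrian A \<xi> L" "arc \<gamma> \<and> path_image \<gamma> \<subseteq> L"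
    thus "has_form_integral A \<alpha> \<gamma> 0"
      using legendrian_imp_form_integral_zero[OF assms(1,2,6,4) g _ assms(5)] by blast
  next
    assume int: "\<forall>\<gamma>. arc \<gamma> \<and> path_image \<gamma> \<subseteq> L \<longrightarrow> has_form_integral A \<alpha> \<gamma> 0"
    show "legendrian A \<xi> L"
    proof (rule legendrian_of_form_small[OF assms(1,2,6,5)])
      fix p c and \<eta> :: real
      assume p: "p \<in> L" and c: "c \<in> A" "p \<in> chart_dom c" and \<eta>: "\<eta> > 0"
      have pW: "p \<in> W" using p assms(5) by blast
      have zero: "has_form_integral A \<alpha> \<gamma> 0" if "arc \<gamma>" "path_image \<gamma> \<subseteq> L" for \<gamma>
        using int that by blast
      obtain U where "open U" "p \<in> U" "U \<subseteq> chart_dom c"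
        "\<And>q' q''. q' \<in> L \<inter> U \<Longrightarrow> q'' \<in> L \<inter> U \<Longrightarrow>
          \<bar>form_coeffs \<alpha> c (crd c p) \<bullet> (crd c q'' - crd c q')\<bar> \<le> \<eta> * norm (crd c q'' - crd c q')"
        by (rule form_small_of_form_integrals_zero[OF assms(1) \<alpha> assms(4) g zero p pW c \<eta>]) (assumption, assumption, rule that)
      thus "\<exists>U. open U \<and> p \<in> U \<and> U \<subseteq> chart_dom c \<and> (\<forall>q'\<in>L \<inter> U. \<forall>q''\<in>L \<inter> U.
        \<bar>form_coeffs \<alpha> c (crd c p) \<bullet> (crd c q'' - crd c q')\<bar> \<le> \<eta> * norm (crd c q'' - crd c q'))"
        by (intro exI[of _ U] conjI ballI)
    qed
  qed
qed

end
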